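(* The representation $\pi'=\pi\otimes\mathrm{id}$ of $\mathcal{A}(SU_q(2))$ is given on the spinor basis by $$\pi'(a)|j\mu n\rangle\!\rangle=\alpha^+_{j\mu n}|j^+\mu^+n^+\rangle\!\rangle+\alpha^-_{j\mu n}|j^-\mu^+n^+\rangle\!\rangle,\qquad \pi'(b)|j\mu n\rangle\!\rangle=\beta^+_{j\mu n}|j^+\mu^+n^-\rangle\!\rangle+\beta^-_{j\mu n}|j^-\mu^+n^-\rangle\!\rangle,$$ $$\pi'(a^* )|j\mu n\rangle\!\rangle=\tilde\alpha^+_{j\mu n}|j^+\mu^-n^-\rangle\!\rangle+\tilde\alpha^-_{j\mu n}|j^-\mu^-n^-\rangle\!\rangle,\qquad \pi'(b^* )|j\mu n\rangle\!\rangle=\tilde\beta^+_{j\mu n}|j^+\mu^-n^+\rangle\!\rangle+\tilde\beta^-_{j\mu n}|j^-\mu^-n^+\rangle\!\rangle,$$ where $\alpha^\pm_{j\mu n}$ and $\beta^\pm_{j\mu n}$ are, up to phase factors depending only on $j$, the triangular $2\times2$ matrices $$\alpha^+_{j\mu n}=q^{(\mu+n-\frac12)/2}[j+\mu+1]^{1/2}\begin{pmatrix}q^{-j-\frac12}\frac{[j+n+\frac32]^{1/2}}{[2j+2]}&0\\ q^{\frac12}\frac{[j-n+\frac12]^{1/2}}{[2j+1][2j+2]}&q^{-j}\frac{[j+n+\frac12]^{1/2}}{[2j+1]}\end{pmatrix},$$ $$\alpha^-_{j\mu n}=q^{(\mu+n-\frac12)/2}[j-\mu]^{1/2}\begin{pmatrix}q^{j+1}\frac{[j-n+\frac12]^{1/2}}{[2j+1]}&-q^{\frac12}\frac{[j+n+\frac12]^{1/2}}{[2j][2j+1]}\\0&q^{j+\frac12}\frac{[j-n-\frac12]^{1/2}}{[2j]}\end{pmatrix},$$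 $$\beta^+_{j\mu n}=q^{(\mu+n-\frac12)/2}[j+\mu+1]^{1/2}\begin{pmatrix}\frac{[j-n+\frac32]^{1/2}}{[2j+2]}&0\\-q^{-j-1}\frac{[j+n+\frac12]^{1/2}}{[2j+1][2j+2]}&q^{-\frac12}\frac{[j-n+\frac12]^{1/2}}{[2j+1]}\end{pmatrix},$$ $$\beta^-_{j\mu n}=q^{(\mu+n-\frac12)/2}[j-\mu]^{1/2}\begin{pmatrix}-q^{-\frac12}\frac{[j+n+\frac12]^{1/2}}{[2j+1]}&-q^{j}\frac{[j-n+\frac12]^{1/2}}{[2j][2j+1]}\\0&-\frac{[j+n-\frac12]^{1/2}}{[2j]}\end{pmatrix},$$ and the remaining matrices are the hermitian conjugates $$\tilde\alpha^\pm_{j\mu n}=(\alpha^\mp_{j^\pm\mu^-n^-})^\dagger,\qquad\tilde\beta^\pm_{j\mu n}=(\beta^\mp_{j^\pm\mu^-n^+})^\dagger .$$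
   Context: Fix a real number $q$ with $0<q<1$ and put $[n]=\frac{q^n-q^{-n}}{q-q^{-1}}$. $\mathcal{A}=\mathcal{A}(SU_q(2))$ is the unital complex $*$-algebra generated by $a,b$ with relations $ba=qab$, $b^*a=qab^*$, $bb^*=b^*b$, $a^*a+q^2b^*b=1$, $aa^*+bb^*=1$. For any index $x$ write $x^\pm=x\pm\frac12$. Let $V$ be the inner product space with (algebraic) orthonormal basis $|lmn\rangle$, $l=0,\frac12,1,\frac32,\dots$, $m,n\in\{-l,-l+1,\dots,l\}$. The (left regular) $*$-representation $\pi$ of $\mathcal{A}$ on $V$ is $$\pi(a)|lmn\rangle=A^+_{lmn}|l^+m^+n^+\rangle+A^-_{lmn}|l^-m^+n^+\rangle,\quad \pi(b)|lmn\rangle=B^+_{lmn}|l^+m^+n^-\rangle+B^-_{lmn}|l^-m^+n^-\rangle,$$ $$A^+_{lmn}=q^{(-2l+m+n-1)/2}\Big(\tfrac{[l+m+1][l+n+1]}{[2l+1][2l+2]}\Big)^{1/2},\quad A^-_{lmn}=q^{(2l+m+n+1)/2}\Big(\tfrac{[l-m][l-n]}{[2l][2l+1]}\Big)^{1/2},$$ $$B^+_{lmn}=q^{(m+n-1)/2}\Big(\tfrac{[l+m+1][l-n+1]}{[2l+1][2l+2]}\Big)^{1/2},\quad B^-_{lmn}=-q^{(m+n-1)/2}\Big(\tfrac{[l-m][l+n]}{[2l][2l+1]}\Big)^{1/2}$$ (terms with $l^-<0$ are absent), with $\pi(a^* ),\pi(b^* )$ the adjoints. Let $\mathbb{C}^2$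 have orthonormal basis $|\frac12,\pm\frac12\rangle$ and $W=V\otimes\mathbb{C}^2$. With $C_{j\mu}=q^{-(j+\mu)/2}\frac{[j-\mu]^{1/2}}{[2j]^{1/2}}$, $S_{j\mu}=q^{(j-\mu)/2}\frac{[j+\mu]^{1/2}}{[2j]^{1/2}}$, the orthonormal spinor basis of $W$ is $$|j\mu n\downarrow\rangle=C_{j\mu}|j^-\mu^+n\rangle\otimes|\tfrac12,-\tfrac12\rangle+S_{j\mu}|j^-\mu^-n\rangle\otimes|\tfrac12,+\tfrac12\rangle$$ for $j=\frac12,1,\frac32,\dots$, $\mu=-j,\dots,j$, $n=-j^-,\dots,j^-$, and $$|j\mu n\uparrow\rangle=-S_{j+1,\mu}|j^+\mu^+n\rangle\otimes|\tfrac12,-\tfrac12\rangle+C_{j+1,\mu}|j^+\mu^-n\rangle\otimes|\tfrac12,+\tfrac12\rangle$$ for $j=0,\frac12,1,\dots$, $\mu=-j,\dots,j$, $n=-j^+,\dots,j^+$ (vectors with out-of-range indices occur with coefficient $0$). For $j=0,\frac12,1,\dots$, $\mu=-j,\dots,j$, $n=-j-\frac12,\dots,j+\frac12$, $|j\mu n\rangle\!\rangle$ denotes the pair $(|j\mu n\uparrow\rangle,|j\mu n\downarrow\rangle)^t$, the lower component being zero when $n=\pm(j+\frac12)$ or $j=0$ (matrix entries attached to a zero component are disregarded). A formula $T|j\mu n\rangle\!\rangle=M|j'\mu'n'\rangle\!\rangle$ with scalar matrix $M=\begin{pmatrix}M_{\uparrow\uparrow}&M_{\uparrow\downarrow}\\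 M_{\downarrow\uparrow}&M_{\downarrow\downarrow}\end{pmatrix}$ means $T|j\mu n\uparrow\rangle=M_{\uparrow\uparrow}|j'\mu'n'\uparrow\rangle+M_{\downarrow\uparrow}|j'\mu'n'\downarrow\rangle$ and $T|j\mu n\downarrow\rangle=M_{\downarrow\downarrow}|j'\mu'n'\downarrow\rangle+M_{\uparrow\downarrow}|j'\mu'n'\uparrow\rangle$; similarly for sums of such terms. *)

theory Defs
  imports "HOL-Analysis.Analysis" "HOL-Library.Poly_Mapping"
begin

section \<open>Complex vector spaces with an algebraic basis\<close>

text \<open>The space with algebraic basis indexed by a type \<open>'i\<close> is \<open>'i \<Rightarrow>\<^sub>0 complex\<close>.\<close>

definition pm_scale :: "complex \<Rightarrow> ('i \<Rightarrow>\<^sub>0 complex) \<Rightarrow> ('i \<Rightarrow>\<^sub>0 complex)"  (infixr "*\<^sub>C" 75)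
  where "c *\<^sub>C x = Poly_Mapping.map ((*) c) x"

lemma lookup_pm_scale [simp]: "Poly_Mapping.lookup (c *\<^sub>C x) i = c * Poly_Mapping.lookup x i"
  unfolding pm_scale_def by (simp add: Poly_Mapping.map.rep_eq when_def)

lemma vector_space_pm_scale: "vector_space pm_scale"
  by unfold_locales
    (auto intro!: poly_mapping_eqI simp: lookup_add algebra_simps)

definition pm_inner :: "('i \<Rightarrow>\<^sub>0 complex) \<Rightarrow> ('i \<Rightarrow>\<^sub>0 complex) \<Rightarrow> complex" where
  "pm_inner x y = (\<Sum>i\<in>Poly_Mapping.keys x. cnj (Poly_Mapping.lookup x i) * Poly_Mapping.lookup y i)"

text \<open>Identifying the tensor product of the spaces based on \<open>'i\<close> and \<open>'k\<close> with the space
  based on \<open>'i \<times> 'k\<close>.\<close>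

definition pm_tensor ::
  "('i \<Rightarrow>\<^sub>0 complex) \<Rightarrow> ('k \<Rightarrow>\<^sub>0 complex) \<Rightarrow> ('i \<times> 'k \<Rightarrow>\<^sub>0 complex)"  (infixr "\<otimes>\<^sub>C" 76)
  where "x \<otimes>\<^sub>C y =
    (\<Sum>i\<in>Poly_Mapping.keys x. \<Sum>k\<in>Poly_Mapping.keys y.
      Poly_Mapping.single (i, k) (Poly_Mapping.lookup x i * Poly_Mapping.lookup y k))"

text \<open>The operator \<open>T \<otimes> id\<close>, for linear \<open>T\<close>.\<close>

definition tensor_id ::
  "(('i \<Rightarrow>\<^sub>0 complex) \<Rightarrow> ('i \<Rightarrow>\<^sub>0 complex)) \<Rightarrow> ('i \<times> 'k \<Rightarrow>\<^sub>0 complex) \<Rightarrow> ('i \<times> 'k \<Rightarrow>\<^sub>0 complex)"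
  where "tensor_id T x =
    (\<Sum>(i, k)\<in>Poly_Mapping.keys x.
      Poly_Mapping.lookup x (i, k) *\<^sub>C (T (Poly_Mapping.single i 1) \<otimes>\<^sub>C Poly_Mapping.single k 1))"


section \<open>The algebra of polynomial functions on quantum SU(2)\<close>

datatype gen = Gen_a | Gen_b | Gen_a_star | Gen_b_star

fun gen_star :: "gen \<Rightarrow> gen" where
  "gen_star Gen_a = Gen_a_star"
| "gen_star Gen_b = Gen_b_star"
| "gen_star Gen_a_star = Gen_a"
| "gen_star Gen_b_star = Gen_b"

text \<open>The additive notation for concatenation makes \<open>word \<Rightarrow>\<^sub>0 complex\<close>, with the convolution
  product of the library, the free complex algebra on the four generators.\<close>

datatype word = Word (letters: "gen list")

instantiation word :: monoid_add
begin
definition zero_word :: word where "0 = Word []"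
definition plus_word :: "word \<Rightarrow> word \<Rightarrow> word" where "u + v = Word (letters u @ letters v)"
instance by standard (auto simp: zero_word_def plus_word_def)
end

type_synonym free_alg = "word \<Rightarrow>\<^sub>0 complex"

definition free_gen :: "gen \<Rightarrow> free_alg" where
  "free_gen g = Poly_Mapping.single (Word [g]) 1"

definition free_star :: "free_alg \<Rightarrow> free_alg" where
  "free_star x = (\<Sum>w\<in>Poly_Mapping.keys x.
     Poly_Mapping.single (Word (rev (map gen_star (letters w)))) (cnj (Poly_Mapping.lookup x w)))"

definition relators :: "real \<Rightarrow> free_alg set" where
  "relators q =
    (let a = free_gen Gen_a; b = free_gen Gen_b;
         a' = free_gen Gen_a_star; b' = free_gen Gen_b_star
     in {b * a - complex_of_real q *\<^sub>C (a * b),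
         b' * a - complex_of_real q *\<^sub>C (a * b'),
         b * b' - b' * b,
         a' * a + complex_of_real (q\<^sup>2) *\<^sub>C (b' * b) - 1,
         a * a' + b * b' - 1})"

text \<open>The two-sided *-ideal generated by the relators.\<close>

inductive_set rel_ideal :: "real \<Rightarrow> free_alg set" for q :: real where
  relator: "x \<in> relators q \<Longrightarrow> x \<in> rel_ideal q"
| zero: "0 \<in> rel_ideal q"
| add: "x \<in> rel_ideal q \<Longrightarrow> y \<in> rel_ideal q \<Longrightarrow> x + y \<in> rel_ideal q"
| mult: "x \<in> rel_ideal q \<Longrightarrow> y * x * z \<in> rel_ideal q"
| star: "x \<in> rel_ideal q \<Longrightarrow> free_star x \<in> rel_ideal q"

definition rel_cong :: "real \<Rightarrow> (free_alg \<times> free_alg) set" where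
  "rel_cong q = {(x, y). x - y \<in> rel_ideal q}"

definition SUq2 :: "real \<Rightarrow> free_alg set set" where
  "SUq2 q = UNIV // rel_cong q"

definition SUq2_class :: "real \<Rightarrow> free_alg \<Rightarrow> free_alg set" where
  "SUq2_class q x = rel_cong q `` {x}"

definition SUq2_gen :: "real \<Rightarrow> gen \<Rightarrow> free_alg set" where
  "SUq2_gen q g = SUq2_class q (free_gen g)"

definition SUq2_one :: "real \<Rightarrow> free_alg set" where
  "SUq2_one q = SUq2_class q 1"

definition SUq2_add :: "real \<Rightarrow> free_alg set \<Rightarrow> free_alg set \<Rightarrow> free_alg set" where
  "SUq2_add q X Y = (\<Union>x\<in>X. \<Union>y\<in>Y. SUq2_class q (x + y))"

definition SUq2_mult :: "real \<Rightarrow> free_alg set \<Rightarrow> free_alg set \<Rightarrow> free_alg set" where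
  "SUq2_mult q X Y = (\<Union>x\<in>X. \<Union>y\<in>Y. SUq2_class q (x * y))"

definition SUq2_scale :: "real \<Rightarrow> complex \<Rightarrow> free_alg set \<Rightarrow> free_alg set" where
  "SUq2_scale q c X = (\<Union>x\<in>X. SUq2_class q (c *\<^sub>C x))"

definition SUq2_star :: "real \<Rightarrow> free_alg set \<Rightarrow> free_alg set" where
  "SUq2_star q X = (\<Union>x\<in>X. SUq2_class q (free_star x))"

lemma pm_scale_eq_mult: "c *\<^sub>C x = Poly_Mapping.single 0 c * (x :: free_alg)"
  unfolding pm_scale_def by (rule mult_map_scale_conv_mult)

lemma free_star_superset:
  assumes "finite A" "Poly_Mapping.keys x \<subseteq> A"
  shows "free_star x = (\<Sum>w\<in>A.
     Poly_Mapping.single (Word (rev (map gen_star (letters w)))) (cnj (Poly_Mapping.lookup x w)))"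
  unfolding free_star_def
  by (rule sum.mono_neutral_left) (use assms in \<open>auto simp: in_keys_iff\<close>)

lemma free_star_diff: "free_star (x - y) = free_star x - free_star y"
proof -
  define A where "A = Poly_Mapping.keys x \<union> Poly_Mapping.keys y"
  have A: "finite A" "Poly_Mapping.keys x \<subseteq> A" "Poly_Mapping.keys y \<subseteq> A"
    "Poly_Mapping.keys (x - y) \<subseteq> A"
    by (auto simp: A_def in_keys_iff lookup_minus)
  show ?thesis
    by (simp add: free_star_superset[OF A(1,2)] free_star_superset[OF A(1,3)]
        free_star_superset[OF A(1,4)] lookup_minus single_diff sum_subtractf)
qed

lemma rel_ideal_uminus: "x \<in> rel_ideal q \<Longrightarrow> - x \<in> rel_ideal q"
  using rel_ideal.mult[of x q "-1" 1] by simp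

lemma equiv_rel_cong: "equiv UNIV (rel_cong q)"
proof (rule equivI)
  show "rel_cong q \<subseteq> UNIV \<times> UNIV" by simp
  show "refl (rel_cong q)"
    by (auto simp: refl_on_def rel_cong_def intro: rel_ideal.zero)
  show "sym (rel_cong q)"
    by (auto simp: sym_def rel_cong_def dest: rel_ideal_uminus)
  show "trans (rel_cong q)"
    unfolding trans_def rel_cong_def using rel_ideal.add by fastforce
qed

lemma SUq2_class_eqI: "x - y \<in> rel_ideal q \<Longrightarrow> SUq2_class q x = SUq2_class q y"
  unfolding SUq2_class_def
  by (rule equiv_class_eq[OF equiv_rel_cong]) (simp add: rel_cong_def)

lemma mem_SUq2_class: "y \<in> SUq2_class q x \<longleftrightarrow> x - y \<in> rel_ideal q"
  by (simp add: SUq2_class_def rel_cong_def)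

lemma mem_SUq2_class_self: "x \<in> SUq2_class q x"
  by (simp add: mem_SUq2_class rel_ideal.zero)

lemma SUq2_add_class: "SUq2_add q (SUq2_class q x) (SUq2_class q y) = SUq2_class q (x + y)"
proof -
  have "SUq2_class q (x' + y') = SUq2_class q (x + y)"
    if "x' \<in> SUq2_class q x" "y' \<in> SUq2_class q y" for x' y'
  proof (rule SUq2_class_eqI[symmetric])
    show "x + y - (x' + y') \<in> rel_ideal q"
      using rel_ideal.add[of "x - x'" q "y - y'"] that
      by (simp add: mem_SUq2_class algebra_simps)
  qed
  then show ?thesis unfolding SUq2_add_def using mem_SUq2_class_self by blast
qed

lemma SUq2_mult_class: "SUq2_mult q (SUq2_class q x) (SUq2_class q y) = SUq2_class q (x * y)"
proof -
  have "SUq2_class q (x' * y') = SUq2_class q (x * y)"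
    if "x' \<in> SUq2_class q x" "y' \<in> SUq2_class q y" for x' y'
  proof (rule SUq2_class_eqI[symmetric])
    have "(1 * (x - x') * y) + (x' * (y - y') * 1) \<in> rel_ideal q"
      using that by (intro rel_ideal.add rel_ideal.mult) (simp_all add: mem_SUq2_class)
    then show "x * y - x' * y' \<in> rel_ideal q" by (simp add: algebra_simps)
  qed
  then show ?thesis unfolding SUq2_mult_def using mem_SUq2_class_self by blast
qed

lemma SUq2_scale_class: "SUq2_scale q c (SUq2_class q x) = SUq2_class q (c *\<^sub>C x)"
proof -
  have "SUq2_class q (c *\<^sub>C x') = SUq2_class q (c *\<^sub>C x)" if "x' \<in> SUq2_class q x" for x'
  proof (rule SUq2_class_eqI[symmetric])
    show "c *\<^sub>C x - c *\<^sub>C x' \<in> rel_ideal q"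
      using rel_ideal.mult[of "x - x'" q "Poly_Mapping.single 0 c" 1] that
      by (simp add: mem_SUq2_class pm_scale_eq_mult algebra_simps)
  qed
  then show ?thesis unfolding SUq2_scale_def using mem_SUq2_class_self by blast
qed

lemma SUq2_star_class: "SUq2_star q (SUq2_class q x) = SUq2_class q (free_star x)"
proof -
  have "SUq2_class q (free_star x') = SUq2_class q (free_star x)" if "x' \<in> SUq2_class q x" for x'
    by (rule SUq2_class_eqI[symmetric])
      (use rel_ideal.star[of "x - x'" q] that in \<open>simp add: mem_SUq2_class free_star_diff\<close>)
  then show ?thesis unfolding SUq2_star_def using mem_SUq2_class_self by blast
qed

text \<open>Unital *-representations on a space with orthonormal algebraic basis.\<close>

definition star_rep ::
  "real \<Rightarrow> (free_alg set \<Rightarrow> ('i \<Rightarrow>\<^sub>0 complex) \<Rightarrow> ('i \<Rightarrow>\<^sub>0 complex)) \<Rightarrow> bool" where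
  "star_rep q \<pi> \<longleftrightarrow>
    (\<forall>X\<in>SUq2 q. Vector_Spaces.linear pm_scale pm_scale (\<pi> X)) \<and>
    (\<forall>X\<in>SUq2 q. \<forall>Y\<in>SUq2 q. \<forall>v. \<pi> (SUq2_add q X Y) v = \<pi> X v + \<pi> Y v) \<and>
    (\<forall>X\<in>SUq2 q. \<forall>c v. \<pi> (SUq2_scale q c X) v = c *\<^sub>C \<pi> X v) \<and>
    (\<forall>X\<in>SUq2 q. \<forall>Y\<in>SUq2 q. \<forall>v. \<pi> (SUq2_mult q X Y) v = \<pi> X (\<pi> Y v)) \<and>
    (\<forall>v. \<pi> (SUq2_one q) v = v) \<and>
    (\<forall>X\<in>SUq2 q. \<forall>v w. pm_inner (\<pi> (SUq2_star q X) v) w = pm_inner v (\<pi> X w))"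


section \<open>The left regular representation\<close>

definition qn :: "real \<Rightarrow> real \<Rightarrow> real" where
  "qn q x = (q powr x - q powr (- x)) / (q - inverse q)"

definition spins :: "real set" where
  "spins = {l. \<exists>k::nat. l = real k / 2}"

text \<open>The set \<open>{-l, -l + 1, \<dots>, l}\<close>; it is empty for \<open>l < 0\<close>.\<close>

definition weights :: "real \<Rightarrow> real set" where
  "weights l = {m. \<exists>i::nat. m = - l + real i \<and> m \<le> l}"

definition is_lmn :: "real \<Rightarrow> real \<Rightarrow> real \<Rightarrow> bool" where
  "is_lmn l m n \<longleftrightarrow> l \<in> spins \<and> m \<in> weights l \<and> n \<in> weights l"

typedef lmn = "{(l, m, n). is_lmn l m n}"
proof
  show "(0, 0, 0) \<in> {(l, m, n). is_lmn l m n}"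
    by (auto simp: is_lmn_def spins_def weights_def intro!: exI[of _ "0::nat"])
qed

type_synonym V = "lmn \<Rightarrow>\<^sub>0 complex"

text \<open>Kets with indices out of range are zero.\<close>

definition ket :: "real \<Rightarrow> real \<Rightarrow> real \<Rightarrow> V" where
  "ket l m n = (if is_lmn l m n then Poly_Mapping.single (Abs_lmn (l, m, n)) 1 else 0)"

definition A_plus :: "real \<Rightarrow> real \<Rightarrow> real \<Rightarrow> real \<Rightarrow> real" where
  "A_plus q l m n = q powr ((- 2 * l + m + n - 1) / 2) *
     sqrt (qn q (l + m + 1) * qn q (l + n + 1) / (qn q (2 * l + 1) * qn q (2 * l + 2)))"

definition A_minus :: "real \<Rightarrow> real \<Rightarrow> real \<Rightarrow> real \<Rightarrow> real" where
  "A_minus q l m n = q powr ((2 * l + m + n + 1) / 2) *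
     sqrt (qn q (l - m) * qn q (l - n) / (qn q (2 * l) * qn q (2 * l + 1)))"

definition B_plus :: "real \<Rightarrow> real \<Rightarrow> real \<Rightarrow> real \<Rightarrow> real" where
  "B_plus q l m n = q powr ((m + n - 1) / 2) *
     sqrt (qn q (l + m + 1) * qn q (l - n + 1) / (qn q (2 * l + 1) * qn q (2 * l + 2)))"

definition B_minus :: "real \<Rightarrow> real \<Rightarrow> real \<Rightarrow> real \<Rightarrow> real" where
  "B_minus q l m n = - (q powr ((m + n - 1) / 2)) *
     sqrt (qn q (l - m) * qn q (l + n) / (qn q (2 * l) * qn q (2 * l + 1)))"

text \<open>The operators of \<open>a\<^sup>*\<close> and \<open>b\<^sup>*\<close> are the adjoints by the last clause of
  \<open>star_rep\<close>, and the clauses below determine \<open>\<pi>\<close> on \<open>SUq2 q\<close>.\<close>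

definition left_regular_rep :: "real \<Rightarrow> (free_alg set \<Rightarrow> V \<Rightarrow> V) \<Rightarrow> bool" where
  "left_regular_rep q \<pi> \<longleftrightarrow> star_rep q \<pi> \<and>
    (\<forall>l m n. is_lmn l m n \<longrightarrow>
       \<pi> (SUq2_gen q Gen_a) (ket l m n) =
         complex_of_real (A_plus q l m n) *\<^sub>C ket (l + 1/2) (m + 1/2) (n + 1/2) +
         complex_of_real (A_minus q l m n) *\<^sub>C ket (l - 1/2) (m + 1/2) (n + 1/2) \<and>
       \<pi> (SUq2_gen q Gen_b) (ket l m n) =
         complex_of_real (B_plus q l m n) *\<^sub>C ket (l + 1/2) (m + 1/2) (n - 1/2) +
         complex_of_real (B_minus q l m n) *\<^sub>C ket (l - 1/2) (m + 1/2) (n - 1/2))"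


section \<open>Spinors\<close>

datatype spin = Spin_down | Spin_up

type_synonym W = "lmn \<times> spin \<Rightarrow>\<^sub>0 complex"

definition spin_ket :: "spin \<Rightarrow> (spin \<Rightarrow>\<^sub>0 complex)" where
  "spin_ket s = Poly_Mapping.single s 1"

definition C_coeff :: "real \<Rightarrow> real \<Rightarrow> real \<Rightarrow> real" where
  "C_coeff q j \<mu> = q powr (- (j + \<mu>) / 2) * (sqrt (qn q (j - \<mu>)) / sqrt (qn q (2 * j)))"

definition S_coeff :: "real \<Rightarrow> real \<Rightarrow> real \<Rightarrow> real" where
  "S_coeff q j \<mu> = q powr ((j - \<mu>) / 2) * (sqrt (qn q (j + \<mu>)) / sqrt (qn q (2 * j)))"

text \<open>The components of \<open>|j \<mu> n\<rangle>\<rangle>\<close> are indexed by \<open>1 :: 2\<close> (up) and \<open>2 :: 2\<close> (down).\<close>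

definition is_spinor :: "2 \<Rightarrow> real \<Rightarrow> real \<Rightarrow> real \<Rightarrow> bool" where
  "is_spinor s j \<mu> n \<longleftrightarrow>
    (if s = 1 then j \<in> spins \<and> \<mu> \<in> weights j \<and> n \<in> weights (j + 1/2)
     else j \<in> spins \<and> j \<ge> 1/2 \<and> \<mu> \<in> weights j \<and> n \<in> weights (j - 1/2))"

definition spinor :: "real \<Rightarrow> 2 \<Rightarrow> real \<Rightarrow> real \<Rightarrow> real \<Rightarrow> W" where
  "spinor q s j \<mu> n =
    (if \<not> is_spinor s j \<mu> n then 0
     else if s = 1 then
       - complex_of_real (S_coeff q (j + 1) \<mu>) *\<^sub>C
           (ket (j + 1/2) (\<mu> + 1/2) n \<otimes>\<^sub>C spin_ket Spin_down) +
       complex_of_real (C_coeff q (j + 1) \<mu>) *\<^sub>C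
           (ket (j + 1/2) (\<mu> - 1/2) n \<otimes>\<^sub>C spin_ket Spin_up)
     else
       complex_of_real (C_coeff q j \<mu>) *\<^sub>C
           (ket (j - 1/2) (\<mu> + 1/2) n \<otimes>\<^sub>C spin_ket Spin_down) +
       complex_of_real (S_coeff q j \<mu>) *\<^sub>C
           (ket (j - 1/2) (\<mu> - 1/2) n \<otimes>\<^sub>C spin_ket Spin_up))"

text \<open>The \<open>s\<close>-component of \<open>M |j \<mu> n\<rangle>\<rangle>\<close>: the entry in row \<open>r\<close> and column \<open>s\<close> multiplies
  the basis vector with arrow \<open>r\<close>.\<close>

definition spinor_apply :: "real \<Rightarrow> complex^2^2 \<Rightarrow> real \<Rightarrow> real \<Rightarrow> real \<Rightarrow> 2 \<Rightarrow> W" where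
  "spinor_apply q M j \<mu> n s = (\<Sum>r\<in>UNIV. (M $ r $ s) *\<^sub>C spinor q r j \<mu> n)"

text \<open>\<open>T |j \<mu> n\<rangle>\<rangle> = M |j\<^sup>+ \<mu>' n'\<rangle>\<rangle> + M' |j\<^sup>- \<mu>' n'\<rangle>\<rangle>\<close> with \<open>\<mu>' = \<mu> + dm\<close> and \<open>n' = n + dn\<close>;
  the equation is required only for the nonzero components of \<open>|j \<mu> n\<rangle>\<rangle>\<close>.\<close>

definition spinor_action ::
  "real \<Rightarrow> (W \<Rightarrow> W) \<Rightarrow> real \<Rightarrow> real \<Rightarrow>
   (real \<Rightarrow> real \<Rightarrow> real \<Rightarrow> complex^2^2) \<Rightarrow> (real \<Rightarrow> real \<Rightarrow> real \<Rightarrow> complex^2^2) \<Rightarrow> bool" where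
  "spinor_action q T dm dn M M' \<longleftrightarrow>
    (\<forall>s j \<mu> n. is_spinor s j \<mu> n \<longrightarrow>
       T (spinor q s j \<mu> n) =
         spinor_apply q (M j \<mu> n) (j + 1/2) (\<mu> + dm) (n + dn) s +
         spinor_apply q (M' j \<mu> n) (j - 1/2) (\<mu> + dm) (n + dn) s)"

definition spinor_rep :: "(free_alg set \<Rightarrow> V \<Rightarrow> V) \<Rightarrow> free_alg set \<Rightarrow> W \<Rightarrow> W" where
  "spinor_rep \<pi> X = tensor_id (\<pi> X)"

definition hconj :: "complex^2^2 \<Rightarrow> complex^2^2" where
  "hconj M = (\<chi> r s. cnj (M $ s $ r))"

definition alpha_plus :: "real \<Rightarrow> real \<Rightarrow> real \<Rightarrow> real \<Rightarrow> real^2^2" where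
  "alpha_plus q j \<mu> n = (q powr ((\<mu> + n - 1/2) / 2) * sqrt (qn q (j + \<mu> + 1))) *\<^sub>R
    vector [vector [q powr (- j - 1/2) * (sqrt (qn q (j + n + 3/2)) / qn q (2 * j + 2)), 0],
            vector [q powr (1/2) * (sqrt (qn q (j - n + 1/2)) / (qn q (2 * j + 1) * qn q (2 * j + 2))),
                    q powr (- j) * (sqrt (qn q (j + n + 1/2)) / qn q (2 * j + 1))]]"

definition alpha_minus :: "real \<Rightarrow> real \<Rightarrow> real \<Rightarrow> real \<Rightarrow> real^2^2" where
  "alpha_minus q j \<mu> n = (q powr ((\<mu> + n - 1/2) / 2) * sqrt (qn q (j - \<mu>))) *\<^sub>R
    vector [vector [q powr (j + 1) * (sqrt (qn q (j - n + 1/2)) / qn q (2 * j + 1)),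
                    - (q powr (1/2)) * (sqrt (qn q (j + n + 1/2)) / (qn q (2 * j) * qn q (2 * j + 1)))],
            vector [0, q powr (j + 1/2) * (sqrt (qn q (j - n - 1/2)) / qn q (2 * j))]]"

definition beta_plus :: "real \<Rightarrow> real \<Rightarrow> real \<Rightarrow> real \<Rightarrow> real^2^2" where
  "beta_plus q j \<mu> n = (q powr ((\<mu> + n - 1/2) / 2) * sqrt (qn q (j + \<mu> + 1))) *\<^sub>R
    vector [vector [sqrt (qn q (j - n + 3/2)) / qn q (2 * j + 2), 0],
            vector [- (q powr (- j - 1)) * (sqrt (qn q (j + n + 1/2)) / (qn q (2 * j + 1) * qn q (2 * j + 2))),
                    q powr (- 1/2) * (sqrt (qn q (j - n + 1/2)) / qn q (2 * j + 1))]]"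

definition beta_minus :: "real \<Rightarrow> real \<Rightarrow> real \<Rightarrow> real \<Rightarrow> real^2^2" where
  "beta_minus q j \<mu> n = (q powr ((\<mu> + n - 1/2) / 2) * sqrt (qn q (j - \<mu>))) *\<^sub>R
    vector [vector [- (q powr (- 1/2)) * (sqrt (qn q (j + n + 1/2)) / qn q (2 * j + 1)),
                    - (q powr j) * (sqrt (qn q (j - n + 1/2)) / (qn q (2 * j) * qn q (2 * j + 1)))],
            vector [0, - (sqrt (qn q (j + n - 1/2)) / qn q (2 * j))]]"

definition up_to_phase ::
  "(real \<Rightarrow> real \<Rightarrow> real \<Rightarrow> complex^2^2) \<Rightarrow> (real \<Rightarrow> real \<Rightarrow> real \<Rightarrow> real^2^2) \<Rightarrow> bool" where
  "up_to_phase M N \<longleftrightarrow>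
    (\<exists>\<phi> :: real \<Rightarrow> complex. (\<forall>j. norm (\<phi> j) = 1) \<and>
       (\<forall>j \<mu> n. M j \<mu> n = (\<chi> r s. \<phi> j * complex_of_real (N j \<mu> n $ r $ s))))"

end

theory Submission
  imports Defs
begin

text \<open>
  The coefficients of \<open>\<pi>(a)\<close> and \<open>\<pi>(b)\<close> factor as a common function of \<open>(l, m)\<close> times a function of
  \<open>(l, n)\<close>, and \<open>\<pi>' = \<pi> \<otimes> id\<close> mixes only the indices \<open>l\<close> and \<open>m\<close> of the spinors. Hence the
  \<open>n\<close>-dependence can be carried along as an arbitrary factor, and both generators reduce to the same
  eight scalar identities, one for each ket in the expansion of \<open>\<pi>'(x)|j\<mu>n\<up>\<rangle>\<close> and \<open>\<pi>'(x)|j\<mu>n\<down>\<rangle>\<close>.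
  These follow from \<open>[x + 1] = q [x] + q\<^sup>-\<^sup>x\<close> and \<open>[u + 1] [v] = [v - u] + [u] [v + 1]\<close>, and all
  phases are \<open>1\<close>. Since the spinors form an orthonormal basis, the action of the adjoints is the
  hermitian conjugate, with \<open>(j, \<mu>, n)\<close> shifted accordingly.
\<close>

section \<open>Coefficient identities\<close>

lemma less_inverse_self: assumes "0 < q" "q < (1::real)" shows "q < inverse q"
  using assms by (simp add: field_simps power2_eq_square[symmetric] power_less_one_iff)

lemma qn_pos: assumes "0 < q" "q < 1" "0 < x" shows "0 < qn q x"
proof -
  have "q powr x < 1" "1 < q powr (-x)"
    using assms by (auto simp: powr_less_one powr_minus one_less_inverse_iff powr01_less_one)
  moreover have "q < inverse q" using assms(1,2) by (rule less_inverse_self)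
  ultimately show ?thesis unfolding qn_def by (intro divide_neg_neg) auto
qed

lemma qn_0 [simp]: "qn q 0 = 0" by (simp add: qn_def)

lemma qn_nonneg: assumes "0 < q" "q < 1" "0 \<le> x" shows "0 \<le> qn q x"
  using qn_pos[of q x] assms by (cases "x = 0") auto

lemma qn_denominator: assumes "0 < q" "q < (1::real)" shows "q - inverse q \<noteq> 0"
  using less_inverse_self[OF assms] by simp

text \<open>After multiplication by \<open>D\<close> both sides are the same combination of
  \<open>q powr x\<close> and \<open>q powr (-x)\<close>. This recurrence and
  \<open>qn_add1'\<close> drive the two-term identities for spin-down kets.\<close>

lemma qn_add1: assumes "0 < q" "q < 1" shows "qn q (x + 1) = q * qn q x + q powr (-x)"
proof -
  define D where "D = q - inverse q"
  have D: "D \<noteq> 0" using qn_denominator[OF assms] by (simp add: D_def)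
  have qD: "qn q y = (q powr y - q powr (-y)) / D" for y by (simp add: qn_def D_def)
  have "q * (q powr x - q powr (-x)) + q powr (-x) * D = q powr (x + 1) - q powr (-(x + 1))"
    using assms by (simp add: D_def powr_add powr_diff powr_minus field_simps)
  thus ?thesis using D unfolding qD by (simp add: field_simps)
qed

lemma qn_add1': assumes "0 < q" "q < 1" shows "q * qn q (x + 1) = qn q x + q * q powr x"
proof -
  define D where "D = q - inverse q"
  have D: "D \<noteq> 0" using qn_denominator[OF assms] by (simp add: D_def)
  have qD: "D * qn q y = q powr y - q powr (-y)" for y using D by (simp add: qn_def D_def)
  have "D * (q * qn q (x + 1)) = q * (q powr (x + 1) - q powr (-(x + 1)))"
    using qD[of "x + 1"] by simp
  also have "\<dots> = (q powr x - q powr (-x)) + D * (q * q powr x)"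
    using assms by (simp add: D_def powr_add powr_diff powr_minus field_simps)
  also have "\<dots> = D * (qn q x + q * q powr x)"
    by (simp add: qD[symmetric] distrib_left)
  finally show ?thesis using D by simp
qed

text \<open>The q-analogue of (u + 1) v - u (v + 1) = v - u. It drives the two-term identities for
  spin-up kets, where the radicals in \<mu> occur squared.\<close>

lemma qn_cross: assumes "0 < q" "q < 1"
  shows "qn q (u + 1) * qn q v = qn q (v - u) + qn q u * qn q (v + 1)"
proof -
  define D where "D = q - inverse q"
  have D: "D \<noteq> 0" using qn_denominator[OF assms] by (simp add: D_def)
  have qD: "qn q y = (q powr y - q powr (-y)) / D" for y by (simp add: qn_def D_def)
  have "(q powr (u+1) - q powr (-(u+1))) * (q powr v - q powr (-v))
     = D * (q powr (v-u) - q powr (-(v-u))) + (q powr u - q powr (-u)) * (q powr (v+1) - q powr (-(v+1)))"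
    using assms by (simp add: D_def powr_add powr_diff powr_minus field_simps)
  \<comment> \<open>The term \<open>Z\<close> comes with a single division by \<open>D\<close>,
    hence its weight \<open>D\<close> over the common denominator \<open>D * D\<close>.\<close>
  moreover have "X / D * (Y / D) = Z / D + U / D * (V / D)" if "X * Y = D * Z + U * V" for X Y Z U V
  proof -
    have "X / D * (Y / D) = (X * Y) / (D * D)" by simp
    also have "\<dots> = Z / D + U / D * (V / D)" using D unfolding that by (simp add: add_divide_distrib)
    finally show ?thesis .
  qed
  ultimately show ?thesis unfolding qD by blast
qed

text \<open>The (l, m) part shared by \<open>A_plus\<close> and \<open>B_plus\<close>;
  \<open>lower_factor\<close> is the one shared by \<open>A_minus\<close> and
  \<open>B_minus\<close>. The roots in the denominator stay separate so that each can later be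
  replaced by a single variable.\<close>

definition raise_factor :: "real \<Rightarrow> real \<Rightarrow> real \<Rightarrow> real" where
  "raise_factor q l m
      = q powr (m / 2) * (sqrt (qn q (l + m + 1)) / (sqrt (qn q (2 * l + 1)) * sqrt (qn q (2 * l + 2))))"

definition lower_factor :: "real \<Rightarrow> real \<Rightarrow> real \<Rightarrow> real" where
  "lower_factor q l m
      = q powr (m / 2) * (sqrt (qn q (l - m)) / (sqrt (qn q (2 * l)) * sqrt (qn q (2 * l + 1))))"

text \<open>Over the common denominator q - 1/q, the C term contributes q^(-2\<mu>) - q^(-2j) and
  the S term q^(2j) - q^(-2\<mu>). Their sum telescopes to the numerator of [2j].\<close>

lemma C_S_square_sum: assumes "0 < q" "q < 1" "0 < j" "-j \<le> \<mu>" "\<mu> \<le> j"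
  shows "(C_coeff q j \<mu>)\<^sup>2 + (S_coeff q j \<mu>)\<^sup>2 = 1"
proof -
  have p: "qn q (2*j) > 0" "qn q (j-\<mu>) \<ge> 0" "qn q (j+\<mu>) \<ge> 0" using assms by (auto intro: qn_pos qn_nonneg)
  have 1: "(q powr (x/2))\<^sup>2 = q powr x" for x
    using assms by (simp add: power2_eq_square powr_add[symmetric])
  have "q powr (-(j+\<mu>)) * qn q (j-\<mu>) + q powr (j-\<mu>) * qn q (j+\<mu>) = qn q (2*j)"
    unfolding qn_def times_divide_eq_right add_divide_distrib[symmetric]
    by (rule arg_cong2[where f="(/)"]) (simp_all add: algebra_simps powr_add[symmetric])
  thus ?thesis unfolding C_coeff_def S_coeff_def power_mult_distrib power_divide 1
    using p by (simp add: field_simps)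
qed

section \<open>Coefficients as monomials in powers of q and square roots\<close>

locale quantum_parameter = fixes q :: real assumes q_pos: "0 < q" and q_less_1: "q < 1"
begin

text \<open>Powers of \<open>q\<close> with exponents affine in \<open>j/2\<close> and \<open>\<mu>/2\<close> become monomials in \<open>half_pow j\<close>,
  \<open>half_pow \<mu>\<close> and \<open>quarter\<close>, so that the coefficient identities are rational.\<close>

definition quarter where "quarter = q powr (1/4)"

lemma quarter_pos: "quarter > 0" using q_pos by (simp add: quarter_def)

lemma quarter_powers: "q = quarter^4" "q powr (1/4) = quarter" "q powr (1/2) = quarter^2" "q powr (3/4) = quarter^3"
  using q_pos by (simp_all add: quarter_def power_numeral_reduce powr_add[symmetric])

definition half_pow where "half_pow x = q powr (x/2)"

lemma half_pow_pos: "half_pow x > 0" using q_pos by (simp add: half_pow_def)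

lemma half_pow_add: "half_pow (x + y) = half_pow x * half_pow y"
    by (simp add: half_pow_def powr_add add_divide_distrib)

lemma half_pow_diff: "half_pow (x - y) = half_pow x / half_pow y"
    by (simp add: half_pow_def powr_diff diff_divide_distrib)

lemma half_pow_minus: "half_pow (- y) = 1 / half_pow y" by (simp add: half_pow_def powr_minus_divide)

lemma half_pow_num: "half_pow (1/2) = quarter" "half_pow 1 = quarter^2" "half_pow (3/2) = quarter^3"
  using q_pos quarter_powers(2-4) quarter_powers(1)[symmetric] by (simp_all add: half_pow_def)

lemma C_coeff_half_pow: "C_coeff q j \<mu> = sqrt (qn q (j - \<mu>)) / (sqrt (qn q (2 * j)) * half_pow j * half_pow \<mu>)"
  unfolding C_coeff_def half_pow_def[symmetric] by (simp add: half_pow_add half_pow_minus half_pow_diff)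

lemma S_coeff_half_pow: "S_coeff q j \<mu> = sqrt (qn q (j + \<mu>)) * half_pow j / (sqrt (qn q (2 * j)) * half_pow \<mu>)"
  unfolding S_coeff_def half_pow_def[symmetric] by (simp add: half_pow_diff mult.commute)

lemma raise_factor_half_pow:
  "raise_factor q l m
    = half_pow m * sqrt (qn q (l + m + 1)) / (sqrt (qn q (2 * l + 1)) * sqrt (qn q (2 * l + 2)))"
  by (simp add: raise_factor_def half_pow_def)

lemma lower_factor_half_pow:
  "lower_factor q l m = half_pow m * sqrt (qn q (l - m)) / (sqrt (qn q (2 * l)) * sqrt (qn q (2 * l + 1)))"
  by (simp add: lower_factor_def half_pow_def)

text \<open>The shifts are absorbed into normal forms, for example (j + 3/2) - (\<mu> + 1/2) into j
  - \<mu> + 1, so that equal radicands on the two sides of an identity become syntactically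
  equal.\<close>

lemma spinor_coeffs:
  "C_coeff q (j+1) \<mu> = sqrt (qn q (j-\<mu>+1)) / (sqrt (qn q (2*j+2)) * (half_pow j * quarter^2) * half_pow \<mu>)"
  "S_coeff q (j+1) \<mu> = sqrt (qn q (j+\<mu>+1)) * (half_pow j * quarter^2) / (sqrt (qn q (2*j+2)) * half_pow \<mu>)"
  "C_coeff q (j+3/2) (\<mu>+1/2)
      = sqrt (qn q (j-\<mu>+1)) / (sqrt (qn q (2*j+3)) * (half_pow j * quarter^3) * (half_pow \<mu> * quarter))"
  "S_coeff q (j+3/2) (\<mu>+1/2)
      = sqrt (qn q (j+\<mu>+2)) * (half_pow j * quarter^3) / (sqrt (qn q (2*j+3)) * (half_pow \<mu> * quarter))"
  "C_coeff q (j+1/2) (\<mu>+1/2)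
      = sqrt (qn q (j-\<mu>)) / (sqrt (qn q (2*j+1)) * (half_pow j * quarter) * (half_pow \<mu> * quarter))"
  "S_coeff q (j+1/2) (\<mu>+1/2)
      = sqrt (qn q (j+\<mu>+1)) * (half_pow j * quarter) / (sqrt (qn q (2*j+1)) * (half_pow \<mu> * quarter))"
  "C_coeff q (j-1/2) (\<mu>+1/2)
      = sqrt (qn q (j-\<mu>-1)) / (sqrt (qn q (2*j-1)) * (half_pow j / quarter) * (half_pow \<mu> * quarter))"
  "S_coeff q (j-1/2) (\<mu>+1/2)
      = sqrt (qn q (j+\<mu>)) * (half_pow j / quarter) / (sqrt (qn q (2*j-1)) * (half_pow \<mu> * quarter))"
  unfolding C_coeff_half_pow S_coeff_half_pow half_pow_add half_pow_diff half_pow_num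
  by (simp_all add: algebra_simps)

lemma op_coeffs:
  "raise_factor q (j+1/2) (\<mu>+1/2)
      = half_pow \<mu> * quarter * sqrt (qn q (j+\<mu>+2)) / (sqrt (qn q (2*j+2)) * sqrt (qn q (2*j+3)))"
  "raise_factor q (j+1/2) (\<mu>-1/2)
      = half_pow \<mu> / quarter * sqrt (qn q (j+\<mu>+1)) / (sqrt (qn q (2*j+2)) * sqrt (qn q (2*j+3)))"
  "raise_factor q (j-1/2) (\<mu>+1/2)
      = half_pow \<mu> * quarter * sqrt (qn q (j+\<mu>+1)) / (sqrt (qn q (2*j)) * sqrt (qn q (2*j+1)))"
  "raise_factor q (j-1/2) (\<mu>-1/2)
      = half_pow \<mu> / quarter * sqrt (qn q (j+\<mu>)) / (sqrt (qn q (2*j)) * sqrt (qn q (2*j+1)))"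
  "lower_factor q (j+1/2) (\<mu>+1/2)
      = half_pow \<mu> * quarter * sqrt (qn q (j-\<mu>)) / (sqrt (qn q (2*j+1)) * sqrt (qn q (2*j+2)))"
  "lower_factor q (j+1/2) (\<mu>-1/2)
      = half_pow \<mu> / quarter * sqrt (qn q (j-\<mu>+1)) / (sqrt (qn q (2*j+1)) * sqrt (qn q (2*j+2)))"
  "lower_factor q (j-1/2) (\<mu>+1/2)
      = half_pow \<mu> * quarter * sqrt (qn q (j-\<mu>-1)) / (sqrt (qn q (2*j-1)) * sqrt (qn q (2*j)))"
  "lower_factor q (j-1/2) (\<mu>-1/2)
      = half_pow \<mu> / quarter * sqrt (qn q (j-\<mu>)) / (sqrt (qn q (2*j-1)) * sqrt (qn q (2*j)))"
  unfolding raise_factor_half_pow lower_factor_half_pow half_pow_add half_pow_diff half_pow_num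
  by (simp_all add: algebra_simps)

text \<open>The letters \<open>u\<close>, \<open>d\<close> (up, down) name the row and the column of an entry of the matrix that raises or
  lowers \<open>j\<close>, with the factor depending on \<open>n\<close> removed.\<close>

definition "raise_prefactor j \<mu> = q powr (\<mu>/2+1/4) * sqrt (qn q (j+\<mu>+1))"
definition "lower_prefactor j \<mu> = q powr (\<mu>/2+1/4) * sqrt (qn q (j-\<mu>))"
definition "raise_uu j \<mu> = raise_prefactor j \<mu> / qn q (2*j+2)"
definition "raise_du j \<mu> = raise_prefactor j \<mu> * q powr (-j-1) / (qn q (2*j+1) * qn q (2*j+2))"
definition "raise_dd j \<mu> = raise_prefactor j \<mu> * q powr (-1/2) / qn q (2*j+1)"
definition "lower_uu j \<mu> = lower_prefactor j \<mu> * q powr (-1/2) / qn q (2*j+1)"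
definition "lower_ud j \<mu> = - (lower_prefactor j \<mu> * q powr j / (qn q (2*j) * qn q (2*j+1)))"
definition "lower_dd j \<mu> = lower_prefactor j \<mu> / qn q (2*j)"

lemma prefactors_half_pow:
  "raise_prefactor j \<mu> = half_pow \<mu> * quarter * sqrt (qn q (j+\<mu>+1))"
  "lower_prefactor j \<mu> = half_pow \<mu> * quarter * sqrt (qn q (j-\<mu>))"
  by (simp_all add: raise_prefactor_def lower_prefactor_def half_pow_def quarter_def powr_add)

lemma powr_half_pow:
  "q powr (-j-1) = 1 / ((half_pow j)^2 * quarter^4)" "q powr (-1/2) = 1 / quarter^2" "q powr j = (half_pow j)^2"
proof -
  show "q powr (-j-1) = 1 / ((half_pow j)^2 * quarter^4)" "q powr j = (half_pow j)^2"
    using q_pos unfolding quarter_powers(1)[symmetric]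
    by (simp_all add: powr_diff powr_minus half_pow_def field_simps power2_eq_square powr_add[symmetric])
  show "q powr (-1/2) = 1 / quarter^2"
      using q_pos quarter_powers(3)[symmetric] by (simp add: powr_minus field_simps)
qed

lemmas entry_defs = raise_uu_def raise_du_def raise_dd_def lower_uu_def lower_ud_def lower_dd_def

section \<open>The eight scalar identities\<close>

context fixes j \<mu> :: real assumes j0: "j \<ge> 0"
begin
lemma sqrt_qn_pos: "sqrt (qn q (2*j+1)) > 0" "sqrt (qn q (2*j+2)) > 0" "sqrt (qn q (2*j+3)) > 0"
  using j0 q_pos q_less_1 by (auto intro!: qn_pos)

text \<open>Naming the roots of [2j], ..., [2j+3] makes the identities rational in the new
  variables. The last two relations are \<open>qn_add1\<close> at 2j + 1 and \<open>qn_add1'\<close>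
  at 2j. Only \<open>r0\<close> may vanish, namely for j = 0.\<close>

lemma obtain_roots: obtains r0 r1 r2 r3 where "r0 \<ge> 0" "r1 > 0" "r2 > 0" "r3 > 0"
  "qn q (2*j) = r0^2"
  "qn q (2*j+1) = r1^2" "qn q (2*j+2) = r2^2" "qn q (2*j+3) = r3^2"
  "r2\<^sup>2 = quarter^4 * r1\<^sup>2 + 1 / ((half_pow j)^4 * quarter^4)"
  "quarter^4 * r1\<^sup>2 = r0\<^sup>2 + quarter^4 * (half_pow j)^4"
proof -
  have *: "q * qn q (2*j+1) = qn q (2*j) + q * q powr (2*j)" "qn q (2*j+2) = q * qn q (2*j+1) + q powr (-(2*j+1))"
    using q_pos qn_add1'[OF q_pos q_less_1, of "2*j"] qn_add1[OF q_pos q_less_1, of "2*j+1"]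
    by (simp_all add: field_simps)
  have ep: "q powr (2*j) = (half_pow j)^4" "q powr (-(2*j+1)) = 1 / ((half_pow j)^4 * quarter^4)"
    using q_pos unfolding quarter_powers(1)[symmetric]
    by (simp_all add: half_pow_def powr_minus powr_diff power_numeral_reduce powr_add[symmetric] field_simps)
  show ?thesis
    using *[unfolded ep] sqrt_qn_pos qn_nonneg[OF q_pos q_less_1, of "2*j"] j0
    by (intro that[of "sqrt (qn q (2*j))" "sqrt (qn q (2*j+1))" "sqrt (qn q (2*j+2))" "sqrt (qn q (2*j+3))"])
      (auto simp: quarter_powers(1)[symmetric])
qed

lemmas half_pows_pos = half_pow_pos[of j] half_pow_pos[of \<mu>] quarter_pos

lemmas coeffs_half_pow = spinor_coeffs[of j \<mu>] op_coeffs[of j \<mu>] C_coeff_half_pow[of j \<mu>]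
  S_coeff_half_pow[of j \<mu>] entry_defs[of j \<mu>] prefactors_half_pow[of j \<mu>] powr_half_pow(1,3)[of j] powr_half_pow(2)

text \<open>Kets with l = j + 1 occur in only one target spinor, the up spinor at j + 1/2. Each side
  is therefore a single product, and the factors match one by one.\<close>

lemma up_raise_down:
  "S_coeff q (j+1) \<mu> * raise_factor q (j+1/2) (\<mu>+1/2) = raise_uu j \<mu> * S_coeff q (j+3/2) (\<mu>+1/2)"
proof (rule obtain_roots)
  fix r0 r1 r2 r3 assume r: "0 \<le> r0" "r1 > 0" "r2 > 0" "r3 > 0" and R: "qn q (2*j) = r0^2"
  "qn q (2*j+1) = r1^2" "qn q (2*j+2) = r2^2" "qn q (2*j+3) = r3^2"
  show ?thesis unfolding coeffs_half_pow R using r half_pows_pos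
    by (simp add: field_simps power2_eq_square power3_eq_cube)
qed

lemma up_raise_up:
  "C_coeff q (j+1) \<mu> * raise_factor q (j+1/2) (\<mu>-1/2) = raise_uu j \<mu> * C_coeff q (j+3/2) (\<mu>+1/2)"
proof (rule obtain_roots)
  fix r0 r1 r2 r3 assume r: "0 \<le> r0" "r1 > 0" "r2 > 0" "r3 > 0" and R: "qn q (2*j) = r0^2"
  "qn q (2*j+1) = r1^2" "qn q (2*j+2) = r2^2" "qn q (2*j+3) = r3^2"
  show ?thesis unfolding coeffs_half_pow R using r half_pows_pos
    by (simp add: field_simps power2_eq_square power3_eq_cube)
qed

text \<open>Kets with l = j occur both in the down spinor at j + 1/2 and in the up spinor at j -
  1/2, hence two terms on the right. The radicals in \<mu> are common factors; what remains is the
  relation between [2j+2] and [2j+1].\<close>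

lemma up_lower_down:
  "- S_coeff q (j+1) \<mu> * lower_factor q (j+1/2) (\<mu>+1/2)
    = raise_du j \<mu> * C_coeff q (j+1/2) (\<mu>+1/2) - lower_uu j \<mu> * S_coeff q (j+1/2) (\<mu>+1/2)"
proof (rule obtain_roots)
  fix r0 r1 r2 r3 assume r: "0 \<le> r0" "r1 > 0" "r2 > 0" "r3 > 0" and R: "qn q (2*j) = r0^2"
  "qn q (2*j+1) = r1^2" "qn q (2*j+2) = r2^2" "qn q (2*j+3) = r3^2"
  and E: "r2\<^sup>2 = quarter^4 * r1\<^sup>2 + 1 / ((half_pow j)^4 * quarter^4)"
  \<comment> \<open>The relation is cleared of denominators because \<open>algebra\<close> works
    with polynomial equations.\<close>
  have E': "r2\<^sup>2 * ((half_pow j)^4 * quarter^4) = quarter^8 * r1\<^sup>2 * (half_pow j)^4 + 1"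
    unfolding E using half_pows_pos by (simp add: field_simps)
  show ?thesis unfolding coeffs_half_pow R using r half_pows_pos
    by (simp add: field_simps) (use E' in algebra)
qed

lemma down_raise_down:
  "0 < j \<Longrightarrow> C_coeff q j \<mu> * raise_factor q (j-1/2) (\<mu>+1/2)
    = raise_dd j \<mu> * C_coeff q (j+1/2) (\<mu>+1/2) - lower_ud j \<mu> * S_coeff q (j+1/2) (\<mu>+1/2)"
proof (rule obtain_roots)
  fix r0 r1 r2 r3 assume j: "j > 0" and r: "0 \<le> r0" "r1 > 0" "r2 > 0" "r3 > 0" and R: "qn q (2*j) = r0^2"
  "qn q (2*j+1) = r1^2" "qn q (2*j+2) = r2^2" "qn q (2*j+3) = r3^2"
  and E: "quarter^4 * r1\<^sup>2 = r0\<^sup>2 + quarter^4 * (half_pow j)^4"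
  have r0: "r0 > 0" using qn_pos[OF q_pos q_less_1, of "2*j"] j r(1) R(1) by (cases "r0 = 0") auto
  show ?thesis unfolding coeffs_half_pow R using r r0 half_pows_pos
    by (simp add: field_simps) (use E in algebra)
qed

text \<open>Here the radicals in \<mu> meet in pairs and become q-numbers, the bounds on \<mu>
  making the radicands nonnegative. The claim reduces to [j-\<mu>+1] [2j+1] = [j+\<mu>+1] +
  [j-\<mu>] [2j+2].\<close>

lemma up_lower_up: assumes "-j \<le> \<mu>" "\<mu> \<le> j"
  shows "C_coeff q (j+1) \<mu> * lower_factor q (j+1/2) (\<mu>-1/2)
    = raise_du j \<mu> * S_coeff q (j+1/2) (\<mu>+1/2) + lower_uu j \<mu> * C_coeff q (j+1/2) (\<mu>+1/2)"
proof (rule obtain_roots)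
  fix r0 r1 r2 r3 assume r: "0 \<le> r0" "r1 > 0" "r2 > 0" "r3 > 0" and R: "qn q (2*j) = r0^2"
  "qn q (2*j+1) = r1^2" "qn q (2*j+2) = r2^2" "qn q (2*j+3) = r3^2"
  define x y z where "x = sqrt (qn q (j+\<mu>+1))" "y = sqrt (qn q (j-\<mu>))" "z = sqrt (qn q (j-\<mu>+1))"
  have "x^2 = qn q (j+\<mu>+1)" "y^2 = qn q (j-\<mu>)" "z^2 = qn q (j-\<mu>+1)"
    unfolding x_y_z_def using assms by (auto intro!: real_sqrt_pow2 qn_nonneg q_pos q_less_1)
  with qn_cross[OF q_pos q_less_1, of "j-\<mu>" "2*j+1"] R have E: "z\<^sup>2 * r1\<^sup>2 = x\<^sup>2 + y\<^sup>2 * r2\<^sup>2"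
    by (simp add: algebra_simps)
  show ?thesis unfolding coeffs_half_pow R x_y_z_def[symmetric] using r half_pows_pos
    by (simp add: field_simps) (use E in algebra)
qed

text \<open>As in \<open>up_lower_up\<close>, now with [j+\<mu>+1] [2j] = [j-\<mu>] + [j+\<mu>]
  [2j+1].\<close>

lemma down_raise_up: assumes "j > 0" "-j \<le> \<mu>" "\<mu> \<le> j"
  shows "S_coeff q j \<mu> * raise_factor q (j-1/2) (\<mu>-1/2)
    = raise_dd j \<mu> * S_coeff q (j+1/2) (\<mu>+1/2) + lower_ud j \<mu> * C_coeff q (j+1/2) (\<mu>+1/2)"
proof (rule obtain_roots)
  fix r0 r1 r2 r3 assume r: "0 \<le> r0" "r1 > 0" "r2 > 0" "r3 > 0" and R: "qn q (2*j) = r0^2"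
  "qn q (2*j+1) = r1^2" "qn q (2*j+2) = r2^2" "qn q (2*j+3) = r3^2"
  have r0: "r0 > 0" using qn_pos[OF q_pos q_less_1, of "2*j"] assms(1) r(1) R(1) by (cases "r0 = 0") auto
  define x y z where "x = sqrt (qn q (j+\<mu>+1))" "y = sqrt (qn q (j-\<mu>))" "z = sqrt (qn q (j+\<mu>))"
  have "x^2 = qn q (j+\<mu>+1)" "y^2 = qn q (j-\<mu>)" "z^2 = qn q (j+\<mu>)"
    unfolding x_y_z_def using assms by (auto intro!: real_sqrt_pow2 qn_nonneg q_pos q_less_1)
  with qn_cross[OF q_pos q_less_1, of "j+\<mu>" "2*j"] R have E: "x\<^sup>2 * r0\<^sup>2 = y\<^sup>2 + z\<^sup>2 * r1\<^sup>2"
    by (simp add: algebra_simps)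
  show ?thesis unfolding coeffs_half_pow R x_y_z_def[symmetric] using r r0 half_pows_pos
    by (simp add: field_simps) (use E in algebra)
qed

text \<open>Kets with l = j - 1 again occur in one target spinor only. At j = 1/2 both sides contain
  a division by the root of [0], and so both are 0.\<close>

lemma down_lower_down:
  "0 < j \<Longrightarrow> C_coeff q j \<mu> * lower_factor q (j-1/2) (\<mu>+1/2) = lower_dd j \<mu> * C_coeff q (j-1/2) (\<mu>+1/2)"
proof (rule obtain_roots)
  fix r0 r1 r2 r3 assume r: "0 \<le> r0" "r1 > 0" "r2 > 0" "r3 > 0" and R: "qn q (2*j) = r0^2"
  "qn q (2*j+1) = r1^2" "qn q (2*j+2) = r2^2" "qn q (2*j+3) = r3^2"
  show ?thesis unfolding coeffs_half_pow R using r half_pows_pos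
    by (simp add: field_simps power2_eq_square power3_eq_cube)
qed

lemma down_lower_up:
  "0 < j \<Longrightarrow> S_coeff q j \<mu> * lower_factor q (j-1/2) (\<mu>-1/2) = lower_dd j \<mu> * S_coeff q (j-1/2) (\<mu>+1/2)"
proof (rule obtain_roots)
  fix r0 r1 r2 r3 assume r: "0 \<le> r0" "r1 > 0" "r2 > 0" "r3 > 0" and R: "qn q (2*j) = r0^2"
  "qn q (2*j+1) = r1^2" "qn q (2*j+2) = r2^2" "qn q (2*j+3) = r3^2"
  show ?thesis unfolding coeffs_half_pow R using r half_pows_pos
    by (simp add: field_simps power2_eq_square power3_eq_cube)
qed

end

end

section \<open>Inner product and tensor product\<close>

interpretation pm: vector_space "pm_scale :: complex \<Rightarrow> ('i \<Rightarrow>\<^sub>0 complex) \<Rightarrow> ('i \<Rightarrow>\<^sub>0 complex)"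
  by (rule vector_space_pm_scale)

lemma pm_decomp: "x = (\<Sum>i\<in>Poly_Mapping.keys x. Poly_Mapping.lookup x i *\<^sub>C Poly_Mapping.single i 1)"
  by (rule poly_mapping_eqI)
    (auto simp: lookup_sum lookup_single when_def if_distrib in_keys_iff sum.delta' cong: if_cong)

lemma pm_basis_induct [case_names zero add scale single]:
  assumes "P 0" "\<And>x y. P x \<Longrightarrow> P y \<Longrightarrow> P (x + y)" "\<And>c x. P x \<Longrightarrow> P (c *\<^sub>C x)"
    "\<And>i. P (Poly_Mapping.single i 1)"
  shows "P x"
proof -
  have "P (\<Sum>i\<in>A. c i *\<^sub>C Poly_Mapping.single i 1)" if "finite A" for A c
    using that by induction (auto intro: assms)
  thus ?thesis by (subst pm_decomp) simp
qed

section \<open>The inner product as a sesquilinear form\<close>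

lemma pm_inner_superset:
  assumes "finite A" "Poly_Mapping.keys x \<subseteq> A"
  shows "pm_inner x y = (\<Sum>i\<in>A. cnj (Poly_Mapping.lookup x i) * Poly_Mapping.lookup y i)"
  unfolding pm_inner_def
  by (rule sum.mono_neutral_left) (use assms in \<open>auto simp: in_keys_iff\<close>)

lemma pm_inner_add_right: "pm_inner x (y + z) = pm_inner x y + pm_inner x z"
  by (simp add: pm_inner_def lookup_add distrib_left sum.distrib)

lemma pm_inner_scale_right: "pm_inner x (c *\<^sub>C y) = c * pm_inner x y"
  by (simp add: pm_inner_def sum_distrib_left mult_ac)

lemma pm_inner_cnj: "cnj (pm_inner x y) = pm_inner y x"
proof -
  define A where "A = Poly_Mapping.keys x \<union> Poly_Mapping.keys y"
  have "finite A" "Poly_Mapping.keys x \<subseteq> A" "Poly_Mapping.keys y \<subseteq> A" by (auto simp: A_def)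
  thus ?thesis by (simp add: pm_inner_superset mult.commute)
qed

lemma pm_inner_add_left: "pm_inner (x + y) z = pm_inner x z + pm_inner y z"
  by (metis pm_inner_add_right pm_inner_cnj complex_cnj_add)

lemma pm_inner_scale_left: "pm_inner (c *\<^sub>C x) y = cnj c * pm_inner x y"
  by (metis pm_inner_scale_right pm_inner_cnj complex_cnj_mult)

lemma pm_inner_single_left: "pm_inner (Poly_Mapping.single i 1) y = Poly_Mapping.lookup y i"
  by (simp add: pm_inner_def)

lemma pm_inner_single_right: "pm_inner x (Poly_Mapping.single i 1) = cnj (Poly_Mapping.lookup x i)"
  by (metis pm_inner_single_left pm_inner_cnj)

lemma pm_inner_zero [simp]: "pm_inner 0 y = 0" "pm_inner x 0 = 0"
  by (simp_all add: pm_inner_def)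

lemma pm_inner_diff_right: "pm_inner x (y - z) = pm_inner x y - pm_inner x z"
  by (simp add: pm_inner_def lookup_minus right_diff_distrib sum_subtractf)

lemma pm_inner_diff_left: "pm_inner (x - y) z = pm_inner x z - pm_inner y z"
  by (metis pm_inner_diff_right pm_inner_cnj complex_cnj_diff)

lemmas pm_inner_simps = pm_inner_diff_left pm_inner_add_left pm_inner_add_right pm_inner_scale_left
  pm_inner_scale_right
  pm_inner_diff_right

lemma pm_inner_eqI:
  assumes "\<And>i. pm_inner x (Poly_Mapping.single i 1) = pm_inner y (Poly_Mapping.single i 1)"
  shows "x = y"
  using assms by (intro poly_mapping_eqI) (simp add: pm_inner_single_right)

section \<open>Tensor products and operators of the form T tensor id\<close>

lemma lookup_pm_tensor:
  "Poly_Mapping.lookup (x \<otimes>\<^sub>C y) (i, k) = Poly_Mapping.lookup x i * Poly_Mapping.lookup y k"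
proof -
  have "Poly_Mapping.lookup (x \<otimes>\<^sub>C y) (i, k) = (\<Sum>i'\<in>Poly_Mapping.keys x. \<Sum>k'\<in>Poly_Mapping.keys y.
      if i' = i then if k' = k then Poly_Mapping.lookup x i * Poly_Mapping.lookup y k else 0 else 0)"
    unfolding pm_tensor_def lookup_sum by (intro sum.cong) (auto simp: lookup_single when_def)
  also have "\<dots> = (\<Sum>i'\<in>Poly_Mapping.keys x. if i' = i then Poly_Mapping.lookup x i * Poly_Mapping.lookup y k else 0)"
    by (intro sum.cong) (auto simp: sum.delta in_keys_iff)
  also have "\<dots> = Poly_Mapping.lookup x i * Poly_Mapping.lookup y k"
    by (auto simp: sum.delta in_keys_iff)
  finally show ?thesis .
qed

lemma pm_tensor_zero [simp]: "0 \<otimes>\<^sub>C y = 0" by (simp add: pm_tensor_def)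

lemma pm_tensor_single: "Poly_Mapping.single i 1 \<otimes>\<^sub>C Poly_Mapping.single k 1 = Poly_Mapping.single (i, k) 1"
  by (simp add: pm_tensor_def)

lemma pm_tensor_add: "(x + y) \<otimes>\<^sub>C z = x \<otimes>\<^sub>C z + y \<otimes>\<^sub>C z"
  by (rule poly_mapping_eqI) (auto simp: lookup_pm_tensor lookup_add distrib_right)

lemma pm_tensor_scale: "(c *\<^sub>C x) \<otimes>\<^sub>C z = c *\<^sub>C (x \<otimes>\<^sub>C z)"
  by (rule poly_mapping_eqI) (auto simp: lookup_pm_tensor)

lemma pm_inner_tensor_single:
  "pm_inner (x \<otimes>\<^sub>C Poly_Mapping.single k 1) (Poly_Mapping.single (i, k') 1) =
    (if k = k' then pm_inner x (Poly_Mapping.single i 1) else 0)"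
  by (simp add: pm_inner_single_right lookup_pm_tensor lookup_single)

text \<open>Sums over different supports can be compared termwise once they run over a common finite
  set.\<close>

lemma tensor_id_superset:
  assumes "finite A" "Poly_Mapping.keys x \<subseteq> A"
  shows "tensor_id T x = (\<Sum>(i, k)\<in>A.
      Poly_Mapping.lookup x (i, k) *\<^sub>C (T (Poly_Mapping.single i 1) \<otimes>\<^sub>C Poly_Mapping.single k 1))"
  unfolding tensor_id_def
  by (rule sum.mono_neutral_left) (use assms in \<open>auto simp: in_keys_iff\<close>)

lemma tensor_id_add: "tensor_id T (x + y) = tensor_id T x + tensor_id T y"
proof -
  define A where "A = Poly_Mapping.keys x \<union> Poly_Mapping.keys y"
  have A: "finite A" "Poly_Mapping.keys x \<subseteq> A" "Poly_Mapping.keys y \<subseteq> A"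
    "Poly_Mapping.keys (x + y) \<subseteq> A"
    by (auto simp: A_def in_keys_iff lookup_add)
  show ?thesis
    unfolding A(2-4)[THEN tensor_id_superset[OF A(1)]] sum.distrib[symmetric]
    by (intro sum.cong) (auto simp: lookup_add pm.scale_left_distrib)
qed

lemma tensor_id_scale: "tensor_id T (c *\<^sub>C x) = c *\<^sub>C tensor_id T x"
proof -
  have A: "Poly_Mapping.keys (c *\<^sub>C x) \<subseteq> Poly_Mapping.keys x" by (auto simp: in_keys_iff)
  show ?thesis
    unfolding tensor_id_superset[OF finite_keys A] unfolding tensor_id_def pm.scale_sum_right
    by (intro sum.cong) auto
qed

lemma tensor_id_single:
  "tensor_id T (Poly_Mapping.single (i, k) 1) = T (Poly_Mapping.single i 1) \<otimes>\<^sub>C Poly_Mapping.single k 1"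
  by (simp add: tensor_id_def)

lemma tensor_id_zero: "tensor_id T 0 = 0" by (simp add: tensor_id_def)

text \<open>\<open>tensor_id\<close> is linear by construction, so basis vectors suffice. There both
  sides are a matrix coefficient on the first factor if the second indices agree, and 0
  otherwise.\<close>

lemma tensor_id_adjoint:
  assumes adj: "\<And>x y. pm_inner (S x) y = pm_inner x (T y)"
  shows "pm_inner (tensor_id S v) w = pm_inner v (tensor_id T w)"
proof (induction v rule: pm_basis_induct)
  case (single p)
  obtain i k where p: "p = (i, k)" by force
  show ?case
  proof (induction w rule: pm_basis_induct)
    case (single p')
    obtain i' k' where p': "p' = (i', k')" by force
    \<comment> \<open>Conjugation moves the tensor to the left slot, where
      \<open>pm_inner_tensor_single\<close> applies.\<close>
    have "pm_inner (Poly_Mapping.single (i,k) 1) (T (Poly_Mapping.single i' 1) \<otimes>\<^sub>C Poly_Mapping.single k' 1)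
       = cnj (pm_inner (T (Poly_Mapping.single i' 1) \<otimes>\<^sub>C Poly_Mapping.single k' 1) (Poly_Mapping.single (i,k) 1))"
      by (simp only: pm_inner_cnj)
    also have "\<dots> = (if k = k' then pm_inner (Poly_Mapping.single i 1) (T (Poly_Mapping.single i' 1)) else 0)"
      by (auto simp: pm_inner_tensor_single pm_inner_cnj)
    finally show ?case
      unfolding p p' tensor_id_single pm_inner_tensor_single adj by simp
  qed (simp_all add: tensor_id_add tensor_id_scale tensor_id_zero pm_inner_simps)
qed (simp_all add: tensor_id_add tensor_id_scale tensor_id_zero pm_inner_simps)

section \<open>The spinor basis\<close>

definition Wket :: "real \<Rightarrow> real \<Rightarrow> real \<Rightarrow> spin \<Rightarrow> W" where
  "Wket l m n \<sigma> = ket l m n \<otimes>\<^sub>C spin_ket \<sigma>"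

lemma Wket_single: "is_lmn l m n \<Longrightarrow> Wket l m n \<sigma> = Poly_Mapping.single (Abs_lmn (l, m, n), \<sigma>) 1"
  by (simp add: Wket_def ket_def spin_ket_def pm_tensor_single)

lemma Wket_zero: "\<not> is_lmn l m n \<Longrightarrow> Wket l m n \<sigma> = 0"
  by (simp add: Wket_def ket_def)

lemma Abs_lmn_eq: "is_lmn l m n \<Longrightarrow> is_lmn l' m' n' \<Longrightarrow>
    Abs_lmn (l, m, n) = Abs_lmn (l', m', n') \<longleftrightarrow> l = l' \<and> m = m' \<and> n = n'"
  by (subst Abs_lmn_inject) auto

lemma Wket_inner: "pm_inner (Wket l m n \<sigma>) (Wket l' m' n' \<sigma>') =
    (if is_lmn l m n \<and> l = l' \<and> m = m' \<and> n = n' \<and> \<sigma> = \<sigma>' then 1 else 0)"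
  by (cases "is_lmn l m n"; cases "is_lmn l' m' n'")
    (auto simp: Wket_zero Wket_single pm_inner_single_left lookup_single when_def Abs_lmn_eq)

lemma W_basis_cases: obtains l m n where "is_lmn l m n" "Poly_Mapping.single p (1::complex) = Wket l m n (snd p)"
proof -
  obtain x \<sigma> where p: "p = (x, \<sigma>)" by force
  obtain l m n where "x = Abs_lmn (l, m, n)" "is_lmn l m n" by (cases x) auto
  thus ?thesis using that p by (simp add: Wket_single)
qed

section \<open>Ranges of spins and weights\<close>

lemma spins_plus: "j \<in> spins \<Longrightarrow> j + 1/2 \<in> spins"
proof -
  assume "j \<in> spins"
  then obtain k :: nat where "j = real k / 2" by (auto simp: spins_def)
  thus ?thesis unfolding spins_def by (auto intro!: exI[of _ "Suc k"])
qed

lemma spins_nonneg: "j \<in> spins \<Longrightarrow> 0 \<le> j" by (auto simp: spins_def)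

lemma spins_minus: "j \<in> spins \<Longrightarrow> 0 < j \<Longrightarrow> j - 1/2 \<in> spins"
proof -
  assume "j \<in> spins" "0 < j"
  then obtain k :: nat where k: "j = real k / 2" "k > 0" by (auto simp: spins_def)
  thus ?thesis unfolding spins_def by (auto intro!: exI[of _ "k - 1"])
qed

lemma weights_bounds: "m \<in> weights l \<Longrightarrow> -l \<le> m \<and> m \<le> l" by (auto simp: weights_def)

lemma weights_up: "m \<in> weights l \<Longrightarrow> m + 1/2 \<in> weights (l + 1/2)"
proof -
  assume "m \<in> weights l"
  then obtain i :: nat where "m = -l + i" "m \<le> l" by (auto simp: weights_def)
  thus ?thesis unfolding weights_def by (auto intro!: exI[of _ "Suc i"])
qed

lemma weights_down: "m \<in> weights l \<Longrightarrow> m - 1/2 \<in> weights (l + 1/2)"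
proof -
  assume "m \<in> weights l"
  then obtain i :: nat where "m = -l + i" "m \<le> l" by (auto simp: weights_def)
  thus ?thesis unfolding weights_def by (auto intro!: exI[of _ i])
qed

lemma weights_shrink_down: "m \<in> weights l \<Longrightarrow> m \<noteq> - l \<Longrightarrow> m - 1/2 \<in> weights (l - 1/2)"
proof -
  assume "m \<in> weights l" "m \<noteq> - l"
  then obtain i :: nat where "m = -l + i" "m \<le> l" "i > 0" by (auto simp: weights_def)
  thus ?thesis unfolding weights_def by (auto intro!: exI[of _ "i - 1"])
qed

text \<open>For a half-integral \<open>l\<close> the largest weight is \<open>l\<close> itself, so a
  weight different from \<open>l\<close> is at most l - 1.\<close>

lemma weights_shrink_up: "l \<in> spins \<Longrightarrow> m \<in> weights l \<Longrightarrow> m \<noteq> l \<Longrightarrow> m + 1/2 \<in> weights (l - 1/2)"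
proof -
  assume *: "l \<in> spins" "m \<in> weights l" "m \<noteq> l"
  then obtain i :: nat where i: "m = -l + i" "m < l" by (auto simp: weights_def)
  obtain k :: nat where k: "l = k / 2" using * by (auto simp: spins_def)
  have "real i < real k" using i k by linarith
  hence "real (Suc i) \<le> real k" by simp
  thus ?thesis using i k unfolding weights_def by (auto intro!: exI[of _ i])
qed

lemma index_cases: "(s :: 2) = 1 \<or> s = 2" by (rule exhaust_2)

context quantum_parameter
begin

text \<open>The unguarded formula also represents the zero spinors that occur as targets, because out-of-range
  kets vanish; this spares case distinctions on the boundary of the index range.\<close>

definition raw_spinor :: "2 \<Rightarrow> real \<Rightarrow> real \<Rightarrow> real \<Rightarrow> W" where
  "raw_spinor s j \<mu> n = (if s = 1 then
       complex_of_real (- S_coeff q (j + 1) \<mu>) *\<^sub>C Wket (j + 1/2) (\<mu> + 1/2) n Spin_down +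
       complex_of_real (C_coeff q (j + 1) \<mu>) *\<^sub>C Wket (j + 1/2) (\<mu> - 1/2) n Spin_up
     else
       complex_of_real (C_coeff q j \<mu>) *\<^sub>C Wket (j - 1/2) (\<mu> + 1/2) n Spin_down +
       complex_of_real (S_coeff q j \<mu>) *\<^sub>C Wket (j - 1/2) (\<mu> - 1/2) n Spin_up)"

lemma spinor_eq_raw_spinor_valid: "is_spinor s j \<mu> n \<Longrightarrow> spinor q s j \<mu> n = raw_spinor s j \<mu> n"
  by (simp add: spinor_def raw_spinor_def Wket_def)

text \<open>With \<open>j\<close> and \<mu> in range, a label fails only through \<open>n\<close>,
  or through j = 0 for a down arrow. In both cases the kets of the raw formula are themselves out of
  range.\<close>

lemma spinor_eq_raw_spinor: assumes "j \<in> spins" "\<mu> \<in> weights j"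
  shows "spinor q s j \<mu> n = raw_spinor s j \<mu> n"
proof (cases "is_spinor s j \<mu> n")
  case False
  have "raw_spinor s j \<mu> n = 0"
  proof (cases "s = 1")
    case True
    with False assms have "\<not> is_lmn (j + 1/2) m n" for m by (auto simp: is_spinor_def is_lmn_def)
    thus ?thesis using True by (simp add: raw_spinor_def Wket_zero)
  next
    case s: False
    have "\<not> is_lmn (j - 1/2) m n" for m
      using False s assms by (auto simp: is_spinor_def is_lmn_def dest: spins_nonneg)
    thus ?thesis using s by (simp add: raw_spinor_def Wket_zero)
  qed
  thus ?thesis using False by (simp add: spinor_def)
qed (rule spinor_eq_raw_spinor_valid)

section \<open>Orthonormality and completeness of the spinors\<close>

lemma C_coeff_top: "C_coeff q j j = 0" by (simp add: C_coeff_def)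

lemma S_coeff_bottom: "S_coeff q j (- j) = 0" by (simp add: S_coeff_def)

lemma C_S_square_sum_complex: assumes "0 < j" "-j \<le> \<mu>" "\<mu> \<le> j"
  shows "complex_of_real (C_coeff q j \<mu>) * complex_of_real (C_coeff q j \<mu>)
    + complex_of_real (S_coeff q j \<mu>) * complex_of_real (S_coeff q j \<mu>) = 1"
  using C_S_square_sum[OF q_pos q_less_1 assms] unfolding of_real_mult[symmetric] of_real_add[symmetric]
  by (simp add: power2_eq_square)

text \<open>Equal arrows with different labels share no ket, and equal labels give the sum of
  squares of C and S. Opposite arrows share kets only if the down spinor has the larger
  \<open>j\<close>, by 1; then the two products C S cancel.\<close>

lemma spinor_orthonormal:
  assumes "is_spinor s j \<mu> n" "is_spinor s' j' \<mu>' n'"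
  shows "pm_inner (spinor q s j \<mu> n) (spinor q s' j' \<mu>' n') =
    (if s = s' \<and> j = j' \<and> \<mu> = \<mu>' \<and> n = n' then 1 else 0)"
proof -
  have up: "is_lmn (j + 1/2) (\<mu> + 1/2) n" "is_lmn (j + 1/2) (\<mu> - 1/2) n" "0 < j + 1" "-j \<le> \<mu>" "\<mu> \<le> j"
    if "is_spinor 1 j \<mu> n" for j \<mu> n
    using that
    by (auto simp: is_spinor_def is_lmn_def spins_plus weights_up weights_down dest: weights_bounds spins_nonneg)
  \<comment> \<open>A down spinor at \<mu> = j or \<mu> = -j has one ket out of range, and exactly
    there its coefficient vanishes.\<close>
  have dn: "C_coeff q j \<mu> = 0 \<or> is_lmn (j - 1/2) (\<mu> + 1/2) n" "S_coeff q j \<mu> = 0 \<or> is_lmn (j - 1/2) (\<mu> - 1/2) n"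
     "0 < j" "-j \<le> \<mu>" "\<mu> \<le> j"
    if "is_spinor 2 j \<mu> n" for j \<mu> n
  proof -
    have s: "j \<in> spins" "j > 0" "\<mu> \<in> weights j" "n \<in> weights (j - 1/2)" using that by (auto simp: is_spinor_def)
    show "C_coeff q j \<mu> = 0 \<or> is_lmn (j - 1/2) (\<mu> + 1/2) n"
      using s C_coeff_top weights_shrink_up spins_minus unfolding is_lmn_def by metis
    show "S_coeff q j \<mu> = 0 \<or> is_lmn (j - 1/2) (\<mu> - 1/2) n"
      using s S_coeff_bottom weights_shrink_down spins_minus unfolding is_lmn_def by metis
    show "0 < j" "-j \<le> \<mu>" "\<mu> \<le> j" using s weights_bounds by auto
  qed
  have eq1: "j' = j + 1" if "j + 1/2 = j' - 1/2" using that by simp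
  show ?thesis
    unfolding spinor_eq_raw_spinor_valid[OF assms(1)] spinor_eq_raw_spinor_valid[OF assms(2)]
    using index_cases[of s] index_cases[of s']
  proof (elim disjE)
    assume s: "s = 1" "s' = 1"
    show "pm_inner (raw_spinor s j \<mu> n) (raw_spinor s' j' \<mu>' n') = (if s = s' \<and> j = j' \<and> \<mu> = \<mu>' \<and> n = n' then 1 else 0)"
      using up[of j \<mu> n] assms s C_S_square_sum_complex[of "j+1" \<mu>]
      by (auto simp: raw_spinor_def pm_inner_simps Wket_inner algebra_simps)
  next
    assume s: "s = 2" "s' = 2"
    show "pm_inner (raw_spinor s j \<mu> n) (raw_spinor s' j' \<mu>' n') = (if s = s' \<and> j = j' \<and> \<mu> = \<mu>' \<and> n = n' then 1 else 0)"
      using dn[of j \<mu> n] assms s C_S_square_sum_complex[of j \<mu>]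
      by (auto simp: raw_spinor_def pm_inner_simps Wket_inner)
  next
    assume s: "s = 1" "s' = 2"
    show "pm_inner (raw_spinor s j \<mu> n) (raw_spinor s' j' \<mu>' n') = (if s = s' \<and> j = j' \<and> \<mu> = \<mu>' \<and> n = n' then 1 else 0)"
      using up[of j \<mu> n] assms s eq1
      by (auto simp: raw_spinor_def pm_inner_simps Wket_inner add.commute)
  next
    assume s: "s = 2" "s' = 1"
    have "j = j' + 1" if "j - 1/2 = j' + 1/2" using that by simp
    thus "pm_inner (raw_spinor s j \<mu> n) (raw_spinor s' j' \<mu>' n') = (if s = s' \<and> j = j' \<and> \<mu> = \<mu>' \<and> n = n' then 1 else 0)"
      using up[of j' \<mu>' n'] assms s
      by (auto simp: raw_spinor_def pm_inner_simps Wket_inner add.commute)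
  qed
qed

lemma spinor_inner: "pm_inner (spinor q s j \<mu> n) (spinor q s' j' \<mu>' n') =
    (if is_spinor s j \<mu> n \<and> s = s' \<and> j = j' \<and> \<mu> = \<mu>' \<and> n = n' then 1 else 0)"
proof (cases "is_spinor s j \<mu> n \<and> is_spinor s' j' \<mu>' n'")
  case True thus ?thesis using spinor_orthonormal by auto
next
  case False
  hence "spinor q s j \<mu> n = 0 \<or> spinor q s' j' \<mu>' n' = 0" by (auto simp: spinor_def)
  thus ?thesis using False by auto
qed

text \<open>The down spinor at l + 1/2 and the up spinor at l - 1/2 arise from the same two kets by
  a rotation with entries C and S; this is one row of the inverse rotation.\<close>

lemma Wket_down_spinors: assumes "is_lmn l m n"
  shows "Wket l m n Spin_down = complex_of_real (C_coeff q (l+1/2) (m-1/2)) *\<^sub>C spinor q 2 (l+1/2) (m-1/2) n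
    - complex_of_real (S_coeff q (l+1/2) (m-1/2)) *\<^sub>C spinor q 1 (l-1/2) (m-1/2) n"
proof -
  have l: "l \<in> spins" "m \<in> weights l" "n \<in> weights l" "-l \<le> m" "m \<le> l" "0 \<le> l"
    using assms weights_bounds spins_nonneg by (auto simp: is_lmn_def)
  have 2: "spinor q 2 (l+1/2) (m-1/2) n = raw_spinor 2 (l+1/2) (m-1/2) n"
    using l by (intro spinor_eq_raw_spinor spins_plus weights_down)
  \<comment> \<open>At m = -l the guarded and the raw up spinor may differ, but the coefficient is
    0.\<close>
  have 1: "complex_of_real (S_coeff q (l+1/2) (m-1/2)) *\<^sub>C spinor q 1 (l-1/2) (m-1/2) n
    = complex_of_real (S_coeff q (l+1/2) (m-1/2)) *\<^sub>C raw_spinor 1 (l-1/2) (m-1/2) n"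
  proof (cases "m = - l")
    case True
    hence "m - 1/2 = - (l + 1/2)" by simp
    hence "S_coeff q (l+1/2) (m-1/2) = 0" using S_coeff_bottom by metis
    thus ?thesis by simp
  next
    case False
    hence "0 < l" using l by auto
    thus ?thesis using False l by (simp add: spinor_eq_raw_spinor spins_minus weights_shrink_down)
  qed
  have 3: "l - 1/2 + 1 = l + 1/2" "l - 1/2 + 1/2 = l" "l + 1/2 - 1/2 = l" "m - 1/2 + 1/2 = m" by simp_all
  have "(complex_of_real (C_coeff q (l+1/2) (m-1/2)) * complex_of_real (C_coeff q (l+1/2) (m-1/2)) +
     complex_of_real (S_coeff q (l+1/2) (m-1/2)) * complex_of_real (S_coeff q (l+1/2) (m-1/2))) *\<^sub>C Wket l m n Spin_down
         = Wket l m n Spin_down"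
    using l by (subst C_S_square_sum_complex) auto
  thus ?thesis unfolding 1 2 raw_spinor_def 3
    by (simp add: pm.scale_right_distrib pm.scale_right_diff_distrib pm.scale_left_distrib mult.commute add.commute)
qed

lemma Wket_up_spinors: assumes "is_lmn l m n"
  shows "Wket l m n Spin_up = complex_of_real (S_coeff q (l+1/2) (m+1/2)) *\<^sub>C spinor q 2 (l+1/2) (m+1/2) n
    + complex_of_real (C_coeff q (l+1/2) (m+1/2)) *\<^sub>C spinor q 1 (l-1/2) (m+1/2) n"
proof -
  have l: "l \<in> spins" "m \<in> weights l" "n \<in> weights l" "-l \<le> m" "m \<le> l" "0 \<le> l"
    using assms weights_bounds spins_nonneg by (auto simp: is_lmn_def)
  have 2: "spinor q 2 (l+1/2) (m+1/2) n = raw_spinor 2 (l+1/2) (m+1/2) n"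
    using l by (intro spinor_eq_raw_spinor spins_plus weights_up)
  have 1: "complex_of_real (C_coeff q (l+1/2) (m+1/2)) *\<^sub>C spinor q 1 (l-1/2) (m+1/2) n
    = complex_of_real (C_coeff q (l+1/2) (m+1/2)) *\<^sub>C raw_spinor 1 (l-1/2) (m+1/2) n"
  proof (cases "m = l")
    case True
    thus ?thesis by (simp add: C_coeff_top)
  next
    case False
    hence "0 < l" using l by auto
    thus ?thesis using False l by (simp add: spinor_eq_raw_spinor spins_minus weights_shrink_up)
  qed
  have 3: "l - 1/2 + 1 = l + 1/2" "l - 1/2 + 1/2 = l" "l + 1/2 - 1/2 = l" "m + 1/2 - 1/2 = m" by simp_all
  have "(complex_of_real (C_coeff q (l+1/2) (m+1/2)) * complex_of_real (C_coeff q (l+1/2) (m+1/2)) +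
     complex_of_real (S_coeff q (l+1/2) (m+1/2)) * complex_of_real (S_coeff q (l+1/2) (m+1/2))) *\<^sub>C Wket l m n Spin_up
         = Wket l m n Spin_up"
    using l by (subst C_S_square_sum_complex) auto
  thus ?thesis unfolding 1 2 raw_spinor_def 3
    by (simp add: pm.scale_right_distrib pm.scale_right_diff_distrib pm.scale_left_distrib mult.commute add.commute)
qed

text \<open>Completeness: every ket is a combination of two spinors, so inner products with spinors
  determine all coordinates.\<close>

lemma spinor_eqI:
  assumes "\<And>s j \<mu> n. is_spinor s j \<mu> n \<Longrightarrow> pm_inner x (spinor q s j \<mu> n) = pm_inner y (spinor q s j \<mu> n)"
  shows "x = y"
proof (rule pm_inner_eqI)
  fix p :: "lmn \<times> spin"
  have *: "pm_inner x (spinor q s j \<mu> n) = pm_inner y (spinor q s j \<mu> n)" for s j \<mu> n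
    using assms[of s j \<mu> n] by (cases "is_spinor s j \<mu> n") (auto simp: spinor_def)
  obtain l m n where l: "is_lmn l m n" "Poly_Mapping.single p 1 = Wket l m n (snd p)" by (rule W_basis_cases)
  show "pm_inner x (Poly_Mapping.single p 1) = pm_inner y (Poly_Mapping.single p 1)"
    unfolding l(2)
    by (cases "snd p") (simp_all add: Wket_down_spinors[OF l(1)] Wket_up_spinors[OF l(1)] pm_inner_simps *)
qed

text \<open>A matrix coefficient of \<open>T'\<close> is the conjugate of the transposed coefficient
  of \<open>T\<close>. The step of \<open>T'\<close> from \<open>j\<close> to j + 1/2 reverses a
  lowering step of \<open>T\<close> that starts at j + 1/2, \<mu> - dm, n - dn, which explains the
  exchange of \<open>M\<close> and \<open>M'\<close> and the shifted arguments.\<close>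

lemma adjoint_spinor_action:
  assumes act: "spinor_action q T dm dn M M'"
    and adj: "\<And>v w. pm_inner (T' v) w = pm_inner v (T w)"
  shows "spinor_action q T' (- dm) (- dn)
    (\<lambda>j \<mu> n. hconj (M' (j + 1/2) (\<mu> - dm) (n - dn))) (\<lambda>j \<mu> n. hconj (M (j - 1/2) (\<mu> - dm) (n - dn)))"
  unfolding spinor_action_def
proof (intro allI impI, rule spinor_eqI)
  fix s j \<mu> n s' j' \<mu>' n'
  assume v: "is_spinor s j \<mu> n" and v': "is_spinor s' j' \<mu>' n'"
  have eqs: "j = j' + 1/2 \<longleftrightarrow> j - 1/2 = j'" "j = j' - 1/2 \<longleftrightarrow> j + 1/2 = j'"
    "\<mu> = \<mu>' + dm \<longleftrightarrow> \<mu> - dm = \<mu>'" "n = n' + dn \<longleftrightarrow> n - dn = n'" by auto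
  have 1: "pm_inner (spinor q s j \<mu> n) (spinor_apply q N j2 \<mu>2 n2 s') =
      (if j = j2 \<and> \<mu> = \<mu>2 \<and> n = n2 then N $ s $ s' else 0)" for N j2 \<mu>2 n2
    using index_cases[of s] v
    by (auto simp: spinor_apply_def sum_2 pm_inner_simps spinor_inner)
  have 2: "pm_inner (spinor_apply q N j2 \<mu>2 n2 s) (spinor q s' j' \<mu>' n') =
      (if j2 = j' \<and> \<mu>2 = \<mu>' \<and> n2 = n' then cnj (N $ s' $ s) else 0)" for N j2 \<mu>2 n2
    using index_cases[of s'] v'
    by (auto simp: spinor_apply_def sum_2 pm_inner_simps spinor_inner)
  show "pm_inner (T' (spinor q s j \<mu> n)) (spinor q s' j' \<mu>' n') =
     pm_inner (spinor_apply q (hconj (M' (j + 1/2) (\<mu> - dm) (n - dn))) (j + 1/2) (\<mu> + - dm) (n + - dn) s +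
       spinor_apply q (hconj (M (j - 1/2) (\<mu> - dm) (n - dn))) (j - 1/2) (\<mu> + - dm) (n + - dn) s)
      (spinor q s' j' \<mu>' n')"
    using act[unfolded spinor_action_def, rule_format, OF v']
    by (auto simp: adj pm_inner_simps 1 2 eqs hconj_def)
qed

section \<open>Operators whose coefficients factor into an (l, m) and an (l, n) part\<close>

lemma raw_spinor_shifted:
  "raw_spinor 1 (j+1/2) (\<mu>+1/2) n
      = complex_of_real (- S_coeff q (j+3/2) (\<mu>+1/2)) *\<^sub>C Wket (j+1) (\<mu>+1) n Spin_down
     + complex_of_real (C_coeff q (j+3/2) (\<mu>+1/2)) *\<^sub>C Wket (j+1) \<mu> n Spin_up"
  "raw_spinor 2 (j+1/2) (\<mu>+1/2) n = complex_of_real (C_coeff q (j+1/2) (\<mu>+1/2)) *\<^sub>C Wket j (\<mu>+1) n Spin_down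
     + complex_of_real (S_coeff q (j+1/2) (\<mu>+1/2)) *\<^sub>C Wket j \<mu> n Spin_up"
  "raw_spinor 1 (j-1/2) (\<mu>+1/2) n = complex_of_real (- S_coeff q (j+1/2) (\<mu>+1/2)) *\<^sub>C Wket j (\<mu>+1) n Spin_down
     + complex_of_real (C_coeff q (j+1/2) (\<mu>+1/2)) *\<^sub>C Wket j \<mu> n Spin_up"
  "raw_spinor 2 (j-1/2) (\<mu>+1/2) n = complex_of_real (C_coeff q (j-1/2) (\<mu>+1/2)) *\<^sub>C Wket (j-1) (\<mu>+1) n Spin_down
     + complex_of_real (S_coeff q (j-1/2) (\<mu>+1/2)) *\<^sub>C Wket (j-1) \<mu> n Spin_up"
  unfolding raw_spinor_def by (simp_all add: algebra_simps)

lemma lower_prefactor_top: "lower_prefactor j j = 0" by (simp add: lower_prefactor_def)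

text \<open>Both sides are compared ket by ket, four kets for each arrow. The off-diagonal entries
  connect kets whose \<open>l\<close> changes opposite to \<open>j\<close>: \<open>raise_du\<close>
  goes from l = j + 1/2 to \<open>j\<close> and carries \<open>Fm\<close>, while
  \<open>lower_ud\<close> goes from j - 1/2 to \<open>j\<close> and carries
  \<open>Fp\<close>.\<close>

lemma spinor_action_factorized:
  assumes add: "\<And>x y. T (x + y) = T x + T y" and scale: "\<And>c x. T (c *\<^sub>C x) = c *\<^sub>C T x"
    and T: "\<And>l m n \<sigma>. is_lmn l m n \<Longrightarrow> T (Wket l m n \<sigma>) =
      complex_of_real (raise_factor q l m * Fp l n) *\<^sub>C Wket (l + 1/2) (m + 1/2) (n + d) \<sigma> +
      complex_of_real (lower_factor q l m * Fm l n) *\<^sub>C Wket (l - 1/2) (m + 1/2) (n + d) \<sigma>"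
    and M: "\<And>j \<mu> n. M j \<mu> n $ 1 $ 1 = complex_of_real (raise_uu j \<mu> * Fp (j + 1/2) n)"
      "\<And>j \<mu> n. M j \<mu> n $ 1 $ 2 = 0"
      "\<And>j \<mu> n. M j \<mu> n $ 2 $ 1 = complex_of_real (raise_du j \<mu> * Fm (j + 1/2) n)"
      "\<And>j \<mu> n. M j \<mu> n $ 2 $ 2 = complex_of_real (raise_dd j \<mu> * Fp (j - 1/2) n)"
    and M': "\<And>j \<mu> n. M' j \<mu> n $ 1 $ 1 = complex_of_real (lower_uu j \<mu> * Fm (j + 1/2) n)"
      "\<And>j \<mu> n. M' j \<mu> n $ 1 $ 2 = complex_of_real (lower_ud j \<mu> * Fp (j - 1/2) n)"
      "\<And>j \<mu> n. M' j \<mu> n $ 2 $ 1 = 0"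
      "\<And>j \<mu> n. M' j \<mu> n $ 2 $ 2 = complex_of_real (lower_dd j \<mu> * Fm (j - 1/2) n)"
  shows "spinor_action q T (1/2) d M M'"
  unfolding spinor_action_def
proof (intro allI impI)
  fix s j \<mu> n assume v: "is_spinor s j \<mu> n"
  have j: "j \<in> spins" "\<mu> \<in> weights j" "0 \<le> j" "-j \<le> \<mu>" "\<mu> \<le> j"
    using v weights_bounds spins_nonneg by (auto simp: is_spinor_def split: if_splits)
  have up: "spinor q r (j+1/2) (\<mu>+1/2) (n+d) = raw_spinor r (j+1/2) (\<mu>+1/2) (n+d)" for r
    using j by (intro spinor_eq_raw_spinor spins_plus weights_up)
  \<comment> \<open>At \<mu> = j the target label is out of range, where the raw formula need not
    vanish; the prefactor does.\<close>
  have dn: "complex_of_real (lower_prefactor j \<mu> * x) *\<^sub>C spinor q r (j-1/2) (\<mu>+1/2) (n+d)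
      = complex_of_real (lower_prefactor j \<mu> * x) *\<^sub>C raw_spinor r (j-1/2) (\<mu>+1/2) (n+d)" for r x
  proof (cases "\<mu> = j")
    case True
    thus ?thesis by (simp add: lower_prefactor_top)
  next
    case False
    hence "0 < j" using j by auto
    hence "spinor q r (j-1/2) (\<mu>+1/2) (n+d) = raw_spinor r (j-1/2) (\<mu>+1/2) (n+d)"
      using False j by (intro spinor_eq_raw_spinor spins_minus weights_shrink_up)
    thus ?thesis by simp
  qed
  have lower: "complex_of_real (lower_uu j \<mu> * y) *\<^sub>C spinor q r (j-1/2) (\<mu>+1/2) (n+d)
      = complex_of_real (lower_uu j \<mu> * y) *\<^sub>C raw_spinor r (j-1/2) (\<mu>+1/2) (n+d)"
    "complex_of_real (lower_ud j \<mu> * y) *\<^sub>C spinor q r (j-1/2) (\<mu>+1/2) (n+d)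
        = complex_of_real (lower_ud j \<mu> * y) *\<^sub>C raw_spinor r (j-1/2) (\<mu>+1/2) (n+d)"
    "complex_of_real (lower_dd j \<mu> * y) *\<^sub>C spinor q r (j-1/2) (\<mu>+1/2) (n+d)
        = complex_of_real (lower_dd j \<mu> * y) *\<^sub>C raw_spinor r (j-1/2) (\<mu>+1/2) (n+d)" for r y
    \<comment> \<open>The instances are the cofactors of \<open>lower_prefactor\<close> in the three
      lowering entries.\<close>
    using dn[of "q powr (-1/2) / qn q (2*j+1) * y" r] dn[of "- (q powr j / (qn q (2*j) * qn q (2*j+1))) * y" r]
      dn[of "1 / qn q (2*j) * y" r] by (simp_all add: entry_defs mult.assoc[symmetric])
  show "T (spinor q s j \<mu> n) = spinor_apply q (M j \<mu> n) (j + 1/2) (\<mu> + 1/2) (n + d) s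
      + spinor_apply q (M' j \<mu> n) (j - 1/2) (\<mu> + 1/2) (n + d) s"
    using index_cases[of s]
  proof
    assume s: "s = 1"
    have l: "is_lmn (j + 1/2) (\<mu> + 1/2) n" "is_lmn (j + 1/2) (\<mu> - 1/2) n"
      using v s j by (auto simp: is_spinor_def is_lmn_def spins_plus weights_up weights_down)
    have sh: "j + 1/2 + 1/2 = j + 1" "\<mu> + 1/2 + 1/2 = \<mu> + 1" "j + 1/2 - 1/2 = j" "\<mu> - 1/2 + 1/2 = \<mu>" by simp_all
    have "T (spinor q s j \<mu> n) =
       complex_of_real (- (S_coeff q (j+1) \<mu> * raise_factor q (j+1/2) (\<mu>+1/2)) * Fp (j+1/2) n) *\<^sub>C Wket (j+1) (\<mu>+1) (n+d) Spin_down
     + complex_of_real ((- S_coeff q (j+1) \<mu> * lower_factor q (j+1/2) (\<mu>+1/2)) * Fm (j+1/2) n) *\<^sub>C Wket j (\<mu>+1) (n+d) Spin_down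
     + (complex_of_real ((C_coeff q (j+1) \<mu> * raise_factor q (j+1/2) (\<mu>-1/2)) * Fp (j+1/2) n) *\<^sub>C Wket (j+1) \<mu> (n+d) Spin_up
     + complex_of_real ((C_coeff q (j+1) \<mu> * lower_factor q (j+1/2) (\<mu>-1/2)) * Fm (j+1/2) n) *\<^sub>C Wket j \<mu> (n+d) Spin_up)"
      unfolding spinor_eq_raw_spinor_valid[OF v] unfolding s raw_spinor_def
      by (simp only: if_True refl add scale T[OF l(1)] T[OF l(2)] sh pm.scale_right_distrib pm.scale_scale
          of_real_mult[symmetric] mult.assoc mult_minus_left)
    also have "\<dots> = spinor_apply q (M j \<mu> n) (j + 1/2) (\<mu> + 1/2) (n + d) s
      + spinor_apply q (M' j \<mu> n) (j - 1/2) (\<mu> + 1/2) (n + d) s"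
      \<comment> \<open>Each identity rewrites the coefficient of one ket; collecting terms by
        target spinor then gives the matrix entries.\<close>
      unfolding up_raise_down[OF j(3)] up_raise_up[OF j(3)] up_lower_down[OF j(3)] up_lower_up[OF j(3-5)] s
        spinor_apply_def sum_2 M M' up lower raw_spinor_shifted
      by (simp add: pm.scale_right_distrib pm.scale_left_distrib pm.scale_right_diff_distrib pm.scale_left_diff_distrib algebra_simps)
    finally show ?thesis .
  next
    assume s: "s = 2"
    have j': "0 < j" and n: "n \<in> weights (j - 1/2)" using v s by (auto simp: is_spinor_def)
    have sh: "j - 1/2 + 1/2 = j" "\<mu> + 1/2 + 1/2 = \<mu> + 1" "j - 1/2 - 1/2 = j - 1" "\<mu> - 1/2 + 1/2 = \<mu>" by simp_all
    \<comment> \<open>The formula for \<open>T\<close> is available only for kets in range. At \<mu>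
      = j the ket is not, but C is 0; the same holds for S at \<mu> = -j below.\<close>
    have C: "complex_of_real (C_coeff q j \<mu>) *\<^sub>C T (Wket (j-1/2) (\<mu>+1/2) n \<sigma>)
        = complex_of_real (C_coeff q j \<mu>) *\<^sub>C
       (complex_of_real (raise_factor q (j-1/2) (\<mu>+1/2) * Fp (j-1/2) n) *\<^sub>C Wket j (\<mu>+1) (n+d) \<sigma> +
        complex_of_real (lower_factor q (j-1/2) (\<mu>+1/2) * Fm (j-1/2) n) *\<^sub>C Wket (j-1) (\<mu>+1) (n+d) \<sigma>)" for \<sigma>
    proof (cases "\<mu> = j")
      case False
      hence "is_lmn (j-1/2) (\<mu>+1/2) n" using j j' n by (auto simp: is_lmn_def spins_minus weights_shrink_up)
      thus ?thesis using T[of "j-1/2" "\<mu>+1/2" n \<sigma>] unfolding sh by simp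
    qed (simp add: C_coeff_top)
    have S: "complex_of_real (S_coeff q j \<mu>) *\<^sub>C T (Wket (j-1/2) (\<mu>-1/2) n \<sigma>)
        = complex_of_real (S_coeff q j \<mu>) *\<^sub>C
       (complex_of_real (raise_factor q (j-1/2) (\<mu>-1/2) * Fp (j-1/2) n) *\<^sub>C Wket j \<mu> (n+d) \<sigma> +
        complex_of_real (lower_factor q (j-1/2) (\<mu>-1/2) * Fm (j-1/2) n) *\<^sub>C Wket (j-1) \<mu> (n+d) \<sigma>)" for \<sigma>
    proof (cases "\<mu> = - j")
      case False
      hence "is_lmn (j-1/2) (\<mu>-1/2) n" using j j' n by (auto simp: is_lmn_def spins_minus weights_shrink_down)
      thus ?thesis using T[of "j-1/2" "\<mu>-1/2" n \<sigma>] unfolding sh by simp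
    qed (simp add: S_coeff_bottom)
    have "T (spinor q s j \<mu> n) =
       complex_of_real ((C_coeff q j \<mu> * raise_factor q (j-1/2) (\<mu>+1/2)) * Fp (j-1/2) n) *\<^sub>C Wket j (\<mu>+1) (n+d) Spin_down
     + complex_of_real ((C_coeff q j \<mu> * lower_factor q (j-1/2) (\<mu>+1/2)) * Fm (j-1/2) n) *\<^sub>C Wket (j-1) (\<mu>+1) (n+d) Spin_down
     + (complex_of_real ((S_coeff q j \<mu> * raise_factor q (j-1/2) (\<mu>-1/2)) * Fp (j-1/2) n) *\<^sub>C Wket j \<mu> (n+d) Spin_up
     + complex_of_real ((S_coeff q j \<mu> * lower_factor q (j-1/2) (\<mu>-1/2)) * Fm (j-1/2) n) *\<^sub>C Wket (j-1) \<mu> (n+d) Spin_up)"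
      unfolding spinor_eq_raw_spinor_valid[OF v] unfolding s raw_spinor_def
      by (simp add: add scale C S) (simp add: pm.scale_right_distrib mult.assoc)
    also have "\<dots> = spinor_apply q (M j \<mu> n) (j + 1/2) (\<mu> + 1/2) (n + d) s
      + spinor_apply q (M' j \<mu> n) (j - 1/2) (\<mu> + 1/2) (n + d) s"
      unfolding down_raise_down[OF j(3) j'] down_raise_up[OF j(3) j' j(4,5)] down_lower_down[OF j(3) j']
        down_lower_up[OF j(3) j'] s spinor_apply_def sum_2 M M' up lower raw_spinor_shifted
      by (simp add: pm.scale_right_distrib pm.scale_left_distrib pm.scale_right_diff_distrib pm.scale_left_diff_distrib algebra_simps)
    finally show ?thesis .
  qed
qed

end

section \<open>The action of the generators\<close>

context quantum_parameter begin

section \<open>The factors depending on n and the matrix entries\<close>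

definition "a_raise l n = q powr ((n - 2 * l - 1) / 2) * sqrt (qn q (l + n + 1))"
definition "a_lower l n = q powr ((2 * l + n + 1) / 2) * sqrt (qn q (l - n))"
definition "b_raise l n = q powr ((n - 1) / 2) * sqrt (qn q (l - n + 1))"
definition "b_lower l n = - (q powr ((n - 1) / 2) * sqrt (qn q (l + n)))"

lemma half_pow_double: "half_pow (2 * x) = (half_pow x)^2"
    by (simp add: power2_eq_square half_pow_add[symmetric])

text \<open>The exponents are affine and separate into m/2 and a part free of \<open>m\<close>.
  Since \<open>sqrt\<close> is multiplicative on all reals, no range conditions arise.\<close>

lemma A_B_factor:
  "A_plus q l m n = raise_factor q l m * a_raise l n" "A_minus q l m n = lower_factor q l m * a_lower l n"
  "B_plus q l m n = raise_factor q l m * b_raise l n" "B_minus q l m n = lower_factor q l m * b_lower l n"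
proof -
  have p: "q powr ((- 2 * l + m + n - 1) / 2) = q powr (m/2) * q powr ((n - 2 * l - 1) / 2)"
    "q powr ((2 * l + m + n + 1) / 2) = q powr (m/2) * q powr ((2 * l + n + 1) / 2)"
    "q powr ((m + n - 1) / 2) = q powr (m/2) * q powr ((n - 1) / 2)"
    unfolding powr_add[symmetric] by (simp_all add: field_simps)
  show "A_plus q l m n = raise_factor q l m * a_raise l n" "A_minus q l m n = lower_factor q l m * a_lower l n"
  "B_plus q l m n = raise_factor q l m * b_raise l n" "B_minus q l m n = lower_factor q l m * b_lower l n"
    unfolding A_plus_def A_minus_def B_plus_def B_minus_def p raise_factor_def lower_factor_def a_raise_def
      a_lower_def b_raise_def b_lower_def
    by (simp_all add: real_sqrt_mult real_sqrt_divide)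
qed

lemma a_b_shifted:
  "a_raise (j + 1/2) n = half_pow n / ((half_pow j)^2 * quarter^4) * sqrt (qn q (j + n + 3/2))"
  "a_raise (j - 1/2) n = half_pow n / (half_pow j)^2 * sqrt (qn q (j + n + 1/2))"
  "a_lower (j + 1/2) n = half_pow n * (half_pow j)^2 * quarter^4 * sqrt (qn q (j - n + 1/2))"
  "a_lower (j - 1/2) n = half_pow n * (half_pow j)^2 * sqrt (qn q (j - n - 1/2))"
  "b_raise (j + 1/2) n = half_pow n / quarter^2 * sqrt (qn q (j - n + 3/2))"
  "b_raise (j - 1/2) n = half_pow n / quarter^2 * sqrt (qn q (j - n + 1/2))"
  "b_lower (j + 1/2) n = - (half_pow n / quarter^2 * sqrt (qn q (j + n + 1/2)))"
  "b_lower (j - 1/2) n = - (half_pow n / quarter^2 * sqrt (qn q (j + n - 1/2)))"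
  unfolding a_raise_def a_lower_def b_raise_def b_lower_def half_pow_def[symmetric] half_pow_add half_pow_diff
    half_pow_double half_pow_num using quarter_pos
  by (simp_all add: field_simps)

lemma prefactor: "q powr ((\<mu> + n - 1/2) / 2) = half_pow \<mu> * half_pow n / quarter"
  unfolding half_pow_def[symmetric] half_pow_add half_pow_diff half_pow_num by simp

lemma j_powers:
  "q powr (j + 1) = (half_pow j)^2 * quarter^4" "q powr (j + 1/2) = (half_pow j)^2 * quarter^2"
  "q powr (- j) = 1 / (half_pow j)^2" "q powr (- j - 1/2) = 1 / ((half_pow j)^2 * quarter^2)"
proof -
  show "q powr (j + 1) = (half_pow j)^2 * quarter^4" "q powr (j + 1/2) = (half_pow j)^2 * quarter^2"
    using q_pos
    by (simp_all add: powr_add powr_half_pow(3)[of j] quarter_powers(3)) (simp add: quarter_powers(1)[symmetric])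
  show "q powr (- j) = 1 / (half_pow j)^2" "q powr (- j - 1/2) = 1 / ((half_pow j)^2 * quarter^2)"
    by (simp_all add: powr_diff powr_minus_divide powr_half_pow(3)[of j] quarter_powers(3))
qed

text \<open>The power q^(\<mu>/2 + 1/4) in the prefactors is what remains of q^((\<mu> + n - 1/2)/2)
  once the power q^((n-1)/2) of \<open>b_raise\<close> and \<open>b_lower\<close> is split off. With
  it the same (j, \<mu>) entries serve both generators.\<close>

lemma alpha_beta_entries:
  "alpha_plus q j \<mu> n $ 1 $ 1 = raise_uu j \<mu> * a_raise (j + 1/2) n"
  "alpha_plus q j \<mu> n $ 1 $ 2 = 0"
  "alpha_plus q j \<mu> n $ 2 $ 1 = raise_du j \<mu> * a_lower (j + 1/2) n"
  "alpha_plus q j \<mu> n $ 2 $ 2 = raise_dd j \<mu> * a_raise (j - 1/2) n"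
  "alpha_minus q j \<mu> n $ 1 $ 1 = lower_uu j \<mu> * a_lower (j + 1/2) n"
  "alpha_minus q j \<mu> n $ 1 $ 2 = lower_ud j \<mu> * a_raise (j - 1/2) n"
  "alpha_minus q j \<mu> n $ 2 $ 1 = 0"
  "alpha_minus q j \<mu> n $ 2 $ 2 = lower_dd j \<mu> * a_lower (j - 1/2) n"
  "beta_plus q j \<mu> n $ 1 $ 1 = raise_uu j \<mu> * b_raise (j + 1/2) n"
  "beta_plus q j \<mu> n $ 1 $ 2 = 0"
  "beta_plus q j \<mu> n $ 2 $ 1 = raise_du j \<mu> * b_lower (j + 1/2) n"
  "beta_plus q j \<mu> n $ 2 $ 2 = raise_dd j \<mu> * b_raise (j - 1/2) n"
  "beta_minus q j \<mu> n $ 1 $ 1 = lower_uu j \<mu> * b_lower (j + 1/2) n"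
  "beta_minus q j \<mu> n $ 1 $ 2 = lower_ud j \<mu> * b_raise (j - 1/2) n"
  "beta_minus q j \<mu> n $ 2 $ 1 = 0"
  "beta_minus q j \<mu> n $ 2 $ 2 = lower_dd j \<mu> * b_lower (j - 1/2) n"
  unfolding alpha_plus_def alpha_minus_def beta_plus_def beta_minus_def vector_scaleR_component vector_2
    entry_defs prefactors_half_pow a_b_shifted prefactor j_powers[of j] powr_half_pow(1,3)[of j] powr_half_pow(2) quarter_powers(3)
  using quarter_pos half_pow_pos[of j] half_pow_pos[of \<mu>] half_pow_pos[of n]
  by (simp_all add: divide_simps power2_eq_square power4_eq_xxxx)

section \<open>Transfer from the representation to the spinor action\<close>

lemma SUq2_gen_in: "SUq2_gen q g \<in> SUq2 q"
  unfolding SUq2_gen_def SUq2_class_def SUq2_def by (rule quotientI) simp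

definition cmat :: "real^2^2 \<Rightarrow> complex^2^2" where "cmat M = (\<chi> r s. complex_of_real (M $ r $ s))"

text \<open>The constant phase 1 is a witness.\<close>

lemma cmat_phase: "up_to_phase (\<lambda>j \<mu> n. cmat (N j \<mu> n)) N"
  unfolding up_to_phase_def cmat_def by (intro exI[of _ "\<lambda>_. 1"]) simp

lemma cmat_nth: "cmat M $ r $ s = complex_of_real (M $ r $ s)" by (simp add: cmat_def)

lemma spinor_rep_Wket:
  assumes "is_lmn l m n"
  shows "spinor_rep \<pi> X (Wket l m n \<sigma>) = \<pi> X (ket l m n) \<otimes>\<^sub>C spin_ket \<sigma>"
  using assms by (simp add: spinor_rep_def Wket_single tensor_id_single ket_def spin_ket_def)

lemma a_action: assumes "left_regular_rep q \<pi>"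
  shows "spinor_action q (spinor_rep \<pi> (SUq2_gen q Gen_a)) (1/2) (1/2)
    (\<lambda>j \<mu> n. cmat (alpha_plus q j \<mu> n)) (\<lambda>j \<mu> n. cmat (alpha_minus q j \<mu> n))"
proof (rule spinor_action_factorized[where Fp = a_raise and Fm = a_lower])
  fix l m n \<sigma> assume "is_lmn l m n"
  thus "spinor_rep \<pi> (SUq2_gen q Gen_a) (Wket l m n \<sigma>) =
     complex_of_real (raise_factor q l m * a_raise l n) *\<^sub>C Wket (l + 1/2) (m + 1/2) (n + 1/2) \<sigma> +
     complex_of_real (lower_factor q l m * a_lower l n) *\<^sub>C Wket (l - 1/2) (m + 1/2) (n + 1/2) \<sigma>"
    using assms unfolding left_regular_rep_def
    by (simp only: spinor_rep_Wket) (simp only: pm_tensor_add pm_tensor_scale Wket_def A_B_factor[symmetric])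
qed (simp_all only: spinor_rep_def tensor_id_add tensor_id_scale cmat_nth alpha_beta_entries of_real_0)

lemma b_action: assumes "left_regular_rep q \<pi>"
  shows "spinor_action q (spinor_rep \<pi> (SUq2_gen q Gen_b)) (1/2) (- 1/2)
    (\<lambda>j \<mu> n. cmat (beta_plus q j \<mu> n)) (\<lambda>j \<mu> n. cmat (beta_minus q j \<mu> n))"
proof (rule spinor_action_factorized[where Fp = b_raise and Fm = b_lower])
  fix l m n \<sigma> assume "is_lmn l m n"
  moreover have "n + - 1/2 = n - 1/2" by simp
  ultimately show "spinor_rep \<pi> (SUq2_gen q Gen_b) (Wket l m n \<sigma>) =
     complex_of_real (raise_factor q l m * b_raise l n) *\<^sub>C Wket (l + 1/2) (m + 1/2) (n + - 1/2) \<sigma> +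
     complex_of_real (lower_factor q l m * b_lower l n) *\<^sub>C Wket (l - 1/2) (m + 1/2) (n + - 1/2) \<sigma>"
    using assms unfolding left_regular_rep_def
    by (simp only: spinor_rep_Wket) (simp only: pm_tensor_add pm_tensor_scale Wket_def A_B_factor[symmetric])
qed (simp_all only: spinor_rep_def tensor_id_add tensor_id_scale cmat_nth alpha_beta_entries of_real_0)

text \<open>The adjointness clause of \<open>star_rep\<close> passes through the tensor product with
  the identity.\<close>

lemma spinor_rep_adjoint: assumes "left_regular_rep q \<pi>"
  shows "pm_inner (spinor_rep \<pi> (SUq2_star q (SUq2_gen q g)) v) w = pm_inner v (spinor_rep \<pi> (SUq2_gen q g) w)"
  unfolding spinor_rep_def
  using assms SUq2_gen_in by (intro tensor_id_adjoint) (simp add: left_regular_rep_def star_rep_def)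

end

theorem proposition4p4:
  fixes q :: real and \<pi> :: "free_alg set \<Rightarrow> V \<Rightarrow> V"
  assumes "0 < q" and "q < 1"
    and "left_regular_rep q \<pi>"
  shows "\<exists>\<alpha>p \<alpha>m \<beta>p \<beta>m \<alpha>p' \<alpha>m' \<beta>p' \<beta>m'.
    up_to_phase \<alpha>p (alpha_plus q) \<and> up_to_phase \<alpha>m (alpha_minus q) \<and>
    up_to_phase \<beta>p (beta_plus q) \<and> up_to_phase \<beta>m (beta_minus q) \<and>
    (\<forall>j \<mu> n. \<alpha>p' j \<mu> n = hconj (\<alpha>m (j + 1/2) (\<mu> - 1/2) (n - 1/2))) \<and>
    (\<forall>j \<mu> n. \<alpha>m' j \<mu> n = hconj (\<alpha>p (j - 1/2) (\<mu> - 1/2) (n - 1/2))) \<and>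
    (\<forall>j \<mu> n. \<beta>p' j \<mu> n = hconj (\<beta>m (j + 1/2) (\<mu> - 1/2) (n + 1/2))) \<and>
    (\<forall>j \<mu> n. \<beta>m' j \<mu> n = hconj (\<beta>p (j - 1/2) (\<mu> - 1/2) (n + 1/2))) \<and>
    spinor_action q (spinor_rep \<pi> (SUq2_gen q Gen_a)) (1/2) (1/2) \<alpha>p \<alpha>m \<and>
    spinor_action q (spinor_rep \<pi> (SUq2_gen q Gen_b)) (1/2) (- 1/2) \<beta>p \<beta>m \<and>
    spinor_action q (spinor_rep \<pi> (SUq2_star q (SUq2_gen q Gen_a))) (- 1/2) (- 1/2) \<alpha>p' \<alpha>m' \<and>
    spinor_action q (spinor_rep \<pi> (SUq2_star q (SUq2_gen q Gen_b))) (- 1/2) (1/2) \<beta>p' \<beta>m'"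
proof -
  interpret quantum_parameter q by unfold_locales (use assms in auto)
  let ?ap = "\<lambda>j \<mu> n. cmat (alpha_plus q j \<mu> n)" and ?am = "\<lambda>j \<mu> n. cmat (alpha_minus q j \<mu> n)"
    and ?bp = "\<lambda>j \<mu> n. cmat (beta_plus q j \<mu> n)" and ?bm = "\<lambda>j \<mu> n. cmat (beta_minus q j \<mu> n)"
  let ?ap' = "\<lambda>j \<mu> n. hconj (?am (j + 1/2) (\<mu> - 1/2) (n - 1/2))"
    and ?am' = "\<lambda>j \<mu> n. hconj (?ap (j - 1/2) (\<mu> - 1/2) (n - 1/2))"
    and ?bp' = "\<lambda>j \<mu> n. hconj (?bm (j + 1/2) (\<mu> - 1/2) (n + 1/2))"
    and ?bm' = "\<lambda>j \<mu> n. hconj (?bp (j - 1/2) (\<mu> - 1/2) (n + 1/2))"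
  note a = a_action[OF assms(3)] and b = b_action[OF assms(3)]
  note adj = spinor_rep_adjoint[OF assms(3)]
  have a': "spinor_action q (spinor_rep \<pi> (SUq2_star q (SUq2_gen q Gen_a))) (- 1/2) (- 1/2)
      ?ap' ?am'"
    using adjoint_spinor_action[OF a adj] by simp
  \<comment> \<open>Here dn = -1/2, so the adjoint raises \<open>n\<close> and the matrices are
    evaluated at n + 1/2.\<close>
  have b': "spinor_action q (spinor_rep \<pi> (SUq2_star q (SUq2_gen q Gen_b))) (- 1/2) (1/2)
      ?bp' ?bm'"
    using adjoint_spinor_action[OF b adj] by simp
  show ?thesis
    by (rule exI[of _ ?ap], rule exI[of _ ?am], rule exI[of _ ?bp], rule exI[of _ ?bm],
        rule exI[of _ ?ap'], rule exI[of _ ?am'], rule exI[of _ ?bp'], rule exI[of _ ?bm'])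
      (intro conjI cmat_phase a b a' b' allI refl)
qed

end
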